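(* Let $\mathbb{K}$ be an algebraically closed field of characteristic zero, $f_1,\ldots,f_m\in\mathbb{K}[x_1,\ldots,x_m]$ generating an ideal $I$ with $\mathbb{K}[\mathbf{x}]/I$ finite dimensional (finitely many affine common roots), and let $J=\det(\partial f_i/\partial x_j)_{i,j=1}^m$ be the Jacobian. With the notation below, set $$\ker(\mathfrak{B}_J^{\mathbf{x}}):=\Big\{\lambda=(\lambda_\beta)_{\beta\in E'}\in\mathbb{K}^{E'}:\ \sum_{\alpha\in E,\beta\in E'}c_{\alpha,\beta}(J)\,\mathbf{x}^\alpha\lambda_\beta=0\Big\}.$$ Then $$\sqrt{I}=\Big\{\sum_{\alpha\in E,\beta\in E'}c_{\alpha,\beta}(1)\,\mathbf{x}^\alpha\lambda_\beta:\ \lambda\in\ker(\mathfrak{B}_J^{\mathbf{x}})\Big\}+I.$$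
   Context: Let $\mathbf{x}=(x_1,\ldots,x_m)$, $\mathbf{y}=(y_1,\ldots,y_m)$ and $X_0=(x_1,\ldots,x_m)$, $X_1=(y_1,x_2,\ldots,x_m)$, …, $X_m=(y_1,\ldots,y_m)$ (in $X_i$ the first $i$ coordinates are $y$'s). For $f_0\in\mathbb{K}[\mathbf{x}]$, the Bezoutian of $(f_0,f_1,\ldots,f_m)$ is the polynomial $\mathfrak{B}_{f_0}(\mathbf{x},\mathbf{y})\in\mathbb{K}[\mathbf{x},\mathbf{y}]$ given by the $(m+1)\times(m+1)$ determinant whose row $i$ ($i=0,\ldots,m$) is $\big(f_i(X_0),\ \frac{f_i(X_0)-f_i(X_1)}{x_1-y_1},\ \ldots,\ \frac{f_i(X_{m-1})-f_i(X_m)}{x_m-y_m}\big)$. Write $\mathfrak{B}_{f_0}(\mathbf{x},\mathbf{y})=\sum_{\alpha\in E,\beta\in E'}c_{\alpha,\beta}(f_0)\mathbf{x}^\alpha\mathbf{y}^\beta$ with $c_{\alpha,\beta}(f_0)\in\mathbb{K}$, where $E,E'\subset\mathbb{N}^m$ are finite sets of exponents containing the supports of all Bezoutians considered (here $f_0=1$ and $f_0=J$), coefficients outside the support being $0$. *)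

theory Defs
  imports "HOL-Library.Poly_Mapping" "HOL-Computational_Algebra.Polynomial"
    "HOL-Combinatorics.Permutations"
begin

text \<open>Multivariate polynomials over 'a: finitely supported maps from monomials
  (exponent vectors, variable k having index k) to coefficients.
  K[x_1..x_m] is represented by variables 0..m-1 (x_j is variable j-1);
  in K[x,y] the variable y_j is variable m+j-1.\<close>

type_synonym 'a mpoly = "(nat \<Rightarrow>\<^sub>0 nat) \<Rightarrow>\<^sub>0 'a"

definition mconst :: "'a::comm_ring_1 \<Rightarrow> 'a mpoly" where
  "mconst c = Poly_Mapping.single 0 c"

definition mvar :: "nat \<Rightarrow> 'a::comm_ring_1 mpoly" where
  "mvar k = Poly_Mapping.single (Poly_Mapping.single k 1) 1"

definition mmonom :: "(nat \<Rightarrow>\<^sub>0 nat) \<Rightarrow> 'a::comm_ring_1 mpoly" where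
  "mmonom \<alpha> = Poly_Mapping.single \<alpha> 1"

definition polys_in :: "nat \<Rightarrow> 'a::comm_ring_1 mpoly set" where
  "polys_in n = {p. \<forall>\<alpha>\<in>Poly_Mapping.keys p. Poly_Mapping.keys \<alpha> \<subseteq> {..<n}}"

definition msubst :: "(nat \<Rightarrow> 'a::comm_ring_1 mpoly) \<Rightarrow> 'a mpoly \<Rightarrow> 'a mpoly" where
  "msubst \<sigma> p = (\<Sum>\<alpha>\<in>Poly_Mapping.keys p. mconst (Poly_Mapping.lookup p \<alpha>) * (\<Prod>k\<in>Poly_Mapping.keys \<alpha>. (\<sigma> k) ^ Poly_Mapping.lookup \<alpha> k))"

definition mpderiv :: "nat \<Rightarrow> 'a::comm_ring_1 mpoly \<Rightarrow> 'a mpoly" where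
  "mpderiv k p = (\<Sum>\<alpha>\<in>Poly_Mapping.keys p.
      Poly_Mapping.single (\<alpha> - Poly_Mapping.single k 1) (of_nat (Poly_Mapping.lookup \<alpha> k) * Poly_Mapping.lookup p \<alpha>))"

definition det_on :: "nat set \<Rightarrow> (nat \<Rightarrow> nat \<Rightarrow> 'a::comm_ring_1) \<Rightarrow> 'a" where
  "det_on S A = (\<Sum>p | p permutes S. of_int (sign p) * (\<Prod>i\<in>S. A i (p i)))"

definition gen_ideal :: "nat \<Rightarrow> (nat \<Rightarrow> 'a::comm_ring_1 mpoly) \<Rightarrow> 'a mpoly set" where
  "gen_ideal m fs = {(\<Sum>i=1..m. g i * fs i) | g. \<forall>i\<in>{1..m}. g i \<in> polys_in m}"

definition radical_in :: "nat \<Rightarrow> 'a::comm_ring_1 mpoly set \<Rightarrow> 'a mpoly set" where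
  "radical_in m I = {p \<in> polys_in m. \<exists>k. p ^ k \<in> I}"

definition fin_dim_quotient :: "nat \<Rightarrow> 'a::comm_ring_1 mpoly set \<Rightarrow> bool" where
  "fin_dim_quotient m I \<longleftrightarrow> (\<exists>B. finite B \<and> B \<subseteq> polys_in m \<and>
     (\<forall>p\<in>polys_in m. \<exists>c. p - (\<Sum>b\<in>B. mconst (c b) * b) \<in> I))"

definition jacobian :: "nat \<Rightarrow> (nat \<Rightarrow> 'a::comm_ring_1 mpoly) \<Rightarrow> 'a mpoly" where
  "jacobian m fs = det_on {1..m} (\<lambda>i j. mpderiv (j - 1) (fs i))"

text \<open>the point X_i = (y_1,..,y_i,x_{i+1},..,x_m)\<close>
definition Xsubst :: "nat \<Rightarrow> nat \<Rightarrow> nat \<Rightarrow> 'a::comm_ring_1 mpoly" where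
  "Xsubst m i l = (if l < i then mvar (m + l) else mvar l)"

text \<open>(f(X_{j-1}) - f(X_j)) / (x_j - y_j), j = 1..m (exact quotient)\<close>
definition divdiff :: "nat \<Rightarrow> nat \<Rightarrow> 'a::comm_ring_1 mpoly \<Rightarrow> 'a mpoly" where
  "divdiff m j f = (THE q. q * (mvar (j - 1) - mvar (m + j - 1)) =
      msubst (Xsubst m (j - 1)) f - msubst (Xsubst m j) f)"

definition bezoutian :: "nat \<Rightarrow> (nat \<Rightarrow> 'a::comm_ring_1 mpoly) \<Rightarrow> 'a mpoly \<Rightarrow> 'a mpoly" where
  "bezoutian m fs f0 = det_on {0..m} (\<lambda>i j.
      let fi = (if i = 0 then f0 else fs i) in
      if j = 0 then fi else divdiff m j fi)"

definition yshift :: "nat \<Rightarrow> (nat \<Rightarrow>\<^sub>0 nat) \<Rightarrow> (nat \<Rightarrow>\<^sub>0 nat)" where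
  "yshift m \<beta> = (\<Sum>k\<in>Poly_Mapping.keys \<beta>. Poly_Mapping.single (m + k) (Poly_Mapping.lookup \<beta> k))"

definition bez_coeff :: "nat \<Rightarrow> (nat \<Rightarrow> 'a::comm_ring_1 mpoly) \<Rightarrow> 'a mpoly \<Rightarrow>
    (nat \<Rightarrow>\<^sub>0 nat) \<Rightarrow> (nat \<Rightarrow>\<^sub>0 nat) \<Rightarrow> 'a" where
  "bez_coeff m fs f0 \<alpha> \<beta> = Poly_Mapping.lookup (bezoutian m fs f0) (\<alpha> + yshift m \<beta>)"

end

theory Submission
  imports Defs "Jordan_Normal_Form.Schur_Decomposition" "Jordan_Normal_Form.DL_Rank"
begin

text \<open>
  The Bezoutian of \<open>1\<close> is \<open>\<Delta> = det (\<Delta>\<^sub>j f\<^sub>i)\<close>, and \<open>B\<^sub>h \<equiv> h(x) \<Delta>\<close> modulo \<open>I(x)\<close>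
  while \<open>B\<^sub>h \<equiv> h(y) \<Delta>\<close> modulo \<open>I(y)\<close>.

  Some linear functional \<open>\<tau>\<close> vanishing on \<open>I\<close> (the residue) satisfies
  \<open>\<tau>\<^sub>y (h(y) \<Delta>(x,y)) \<equiv> h(x)\<close> modulo \<open>I\<close> for all \<open>h\<close>. To construct it, pick
  monic univariate \<open>g\<^sub>j(x\<^sub>j) \<in> I\<close> and write \<open>g = M f\<close>. For the system \<open>g\<close> the residue is a product of
  univariate functionals, and \<open>det M(y) \<Delta>\<close> agrees with the Bezoutian of \<open>g\<close> modulo \<open>f(x)\<close> and
  \<open>g(y)\<close>, because two matrices expressing the same elements by the regular sequence \<open>x\<^sub>j - y\<^sub>j\<close> have
  determinants that agree modulo these elements.

  Writing \<open>\<Delta> = \<Sum> a\<^sub>i(x) b\<^sub>i(y)\<close>, the matrices \<open>T\<^sub>h = (\<tau>(h a\<^sub>i b\<^sub>j))\<close> multiply like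
  the classes of the polynomials \<open>h\<close> modulo \<open>I\<close>, and \<open>T\<^sub>h\<close> has trace \<open>\<tau>(h J)\<close> since \<open>J(x) = \<Delta>(x,x)\<close>.
  In characteristic zero this shows that \<open>g J \<in> I\<close> if and only if \<open>g \<in> rad I\<close>.

  If \<open>\<lambda>\<close> annihilates \<open>B\<^sub>J\<close>, then \<open>J \<lambda>(\<Delta>) \<in> I\<close>, so \<open>\<lambda>(\<Delta>) \<in> rad I\<close>. Conversely, \<open>g \<in> rad I\<close> is represented
  modulo \<open>I\<close> by \<open>\<lambda> = \<tau>(g \<cdot>)\<close>, and this \<open>\<lambda>\<close> annihilates \<open>B\<^sub>J\<close> because \<open>g J \<in> I\<close>.
\<close>

subsection \<open>Linear maps on polynomials\<close>

text \<open>The linear map with prescribed values \<open>\<phi>\<close> on monomials. Substitution,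
  partial derivatives and \<open>yapply\<close> are all of this form, so their linearity is proved
  once.\<close>

definition lin_ext :: "((nat \<Rightarrow>\<^sub>0 nat) \<Rightarrow> 'a::comm_ring_1 mpoly) \<Rightarrow> 'a mpoly \<Rightarrow> 'a mpoly" where
  "lin_ext \<phi> p = (\<Sum>\<alpha>\<in>Poly_Mapping.keys p. mconst (Poly_Mapping.lookup p \<alpha>) * \<phi> \<alpha>)"

definition functional :: "((nat \<Rightarrow>\<^sub>0 nat) \<Rightarrow> 'a::comm_ring_1) \<Rightarrow> 'a mpoly \<Rightarrow> 'a" where
  "functional t p = (\<Sum>\<alpha>\<in>Poly_Mapping.keys p. Poly_Mapping.lookup p \<alpha> * t \<alpha>)"

lemma mconst_0 [simp]: "mconst 0 = 0"
  by (simp add: mconst_def)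

lemma mconst_1 [simp]: "mconst 1 = 1"
  by (simp add: mconst_def)

lemma mconst_add: "mconst (a + b) = mconst a + mconst b"
  by (simp add: mconst_def single_add)

lemma mconst_uminus: "mconst (- a) = - mconst a"
  by (simp add: mconst_def single_uminus)

lemma mconst_mult: "mconst (a * b) = mconst a * mconst b"
  by (simp add: mconst_def mult_single)

lemma mconst_sum: "mconst (sum f S) = (\<Sum>i\<in>S. mconst (f i))"
  by (induction S rule: infinite_finite_induct) (auto simp: mconst_add)

lemma mconst_single: "mconst c * Poly_Mapping.single \<alpha> d = Poly_Mapping.single \<alpha> (c * d)"
  by (simp add: mconst_def mult_single)

lemma mmonom_add: "mmonom (\<alpha> + \<beta>) = mmonom \<alpha> * mmonom \<beta>"
  by (simp add: mmonom_def mult_single)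

lemma mmonom_0 [simp]: "mmonom 0 = 1"
  by (simp add: mmonom_def)

lemma lookup_mconst_mult: "Poly_Mapping.lookup (mconst c * p) \<alpha> = c * Poly_Mapping.lookup p \<alpha>"
  by (simp add: mconst_def mult_map_scale_conv_mult[symmetric] Poly_Mapping.map.rep_eq when_def)

lemma keys_mconst_mult: "Poly_Mapping.keys (mconst c * p) \<subseteq> Poly_Mapping.keys p"
  by (auto simp: in_keys_iff lookup_mconst_mult)

lemma lin_ext_superset:
  assumes "finite S" "Poly_Mapping.keys p \<subseteq> S"
  shows "lin_ext \<phi> p = (\<Sum>\<alpha>\<in>S. mconst (Poly_Mapping.lookup p \<alpha>) * \<phi> \<alpha>)"
  unfolding lin_ext_def
  by (rule sum.mono_neutral_left) (use assms in \<open>auto simp: in_keys_iff\<close>)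

lemma functional_superset:
  assumes "finite S" "Poly_Mapping.keys p \<subseteq> S"
  shows "functional t p = (\<Sum>\<alpha>\<in>S. Poly_Mapping.lookup p \<alpha> * t \<alpha>)"
  unfolding functional_def
  by (rule sum.mono_neutral_left) (use assms in \<open>auto simp: in_keys_iff\<close>)

lemma lin_ext_0 [simp]: "lin_ext \<phi> 0 = 0"
  by (simp add: lin_ext_def)

lemma lin_ext_add: "lin_ext \<phi> (p + q) = lin_ext \<phi> p + lin_ext \<phi> q"
proof -
  let ?S = "Poly_Mapping.keys p \<union> Poly_Mapping.keys q"
  have "lin_ext \<phi> (p + q) = (\<Sum>\<alpha>\<in>?S. mconst (Poly_Mapping.lookup (p + q) \<alpha>) * \<phi> \<alpha>)"
    by (rule lin_ext_superset) (use Poly_Mapping.keys_add[of p q] in auto)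
  then show ?thesis
    by (simp add: lin_ext_superset[of ?S p] lin_ext_superset[of ?S q] lookup_add mconst_add
        algebra_simps sum.distrib)
qed

lemma lin_ext_mconst_mult: "lin_ext \<phi> (mconst c * p) = mconst c * lin_ext \<phi> p"
proof -
  have "lin_ext \<phi> (mconst c * p) =
      (\<Sum>\<alpha>\<in>Poly_Mapping.keys p. mconst (Poly_Mapping.lookup (mconst c * p) \<alpha>) * \<phi> \<alpha>)"
    by (rule lin_ext_superset) (use keys_mconst_mult in auto)
  then show ?thesis
    by (simp add: lookup_mconst_mult mconst_mult lin_ext_def sum_distrib_left mult.assoc)
qed

lemma lin_ext_uminus: "lin_ext \<phi> (- p) = - lin_ext \<phi> p"
  using lin_ext_mconst_mult[of \<phi> "- 1" p] by (simp add: mconst_uminus)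

lemma lin_ext_diff: "lin_ext \<phi> (p - q) = lin_ext \<phi> p - lin_ext \<phi> q"
  using lin_ext_add[of \<phi> p "- q"] by (simp add: lin_ext_uminus)

lemma lin_ext_sum: "lin_ext \<phi> (sum f S) = (\<Sum>i\<in>S. lin_ext \<phi> (f i))"
  by (induction S rule: infinite_finite_induct) (auto simp: lin_ext_add)

lemma lin_ext_monom: "lin_ext \<phi> (mmonom \<alpha>) = \<phi> \<alpha>"
  by (simp add: lin_ext_def mmonom_def)

lemma functional_0 [simp]: "functional t 0 = 0"
  by (simp add: functional_def)

lemma functional_add: "functional t (p + q) = functional t p + functional t q"
proof -
  let ?S = "Poly_Mapping.keys p \<union> Poly_Mapping.keys q"
  have "functional t (p + q) = (\<Sum>\<alpha>\<in>?S. Poly_Mapping.lookup (p + q) \<alpha> * t \<alpha>)"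
    by (rule functional_superset) (use Poly_Mapping.keys_add[of p q] in auto)
  then show ?thesis
    by (simp add: functional_superset[of ?S p] functional_superset[of ?S q] lookup_add
        algebra_simps sum.distrib)
qed

lemma functional_mconst_mult: "functional t (mconst c * p) = c * functional t p"
proof -
  have "functional t (mconst c * p) =
      (\<Sum>\<alpha>\<in>Poly_Mapping.keys p. Poly_Mapping.lookup (mconst c * p) \<alpha> * t \<alpha>)"
    by (rule functional_superset) (use keys_mconst_mult in auto)
  then show ?thesis
    by (simp add: lookup_mconst_mult functional_def sum_distrib_left mult.assoc)
qed

lemma functional_uminus: "functional t (- p) = - functional t p"
  using functional_mconst_mult[of t "- 1" p] by (simp add: mconst_uminus)

lemma functional_diff: "functional t (p - q) = functional t p - functional t q"
  using functional_add[of t p "- q"] by (simp add: functional_uminus)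

lemma functional_sum: "functional t (sum f S) = (\<Sum>i\<in>S. functional t (f i))"
  by (induction S rule: infinite_finite_induct) (auto simp: functional_add)

lemma functional_monom: "functional t (mmonom \<alpha>) = t \<alpha>"
  by (simp add: functional_def mmonom_def)

lemma mpoly_expand:
  "p = (\<Sum>\<alpha>\<in>Poly_Mapping.keys p. mconst (Poly_Mapping.lookup p \<alpha>) * mmonom \<alpha>)"
proof (rule poly_mapping_eqI)
  fix \<beta>
  have "Poly_Mapping.lookup (\<Sum>\<alpha>\<in>Poly_Mapping.keys p. mconst (Poly_Mapping.lookup p \<alpha>) * mmonom \<alpha>) \<beta>
     = (\<Sum>\<alpha>\<in>Poly_Mapping.keys p. if \<alpha> = \<beta> then Poly_Mapping.lookup p \<alpha> else 0)"
    by (simp add: lookup_sum lookup_mconst_mult mmonom_def lookup_single when_def if_distrib cong: if_cong)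
  also have "\<dots> = Poly_Mapping.lookup p \<beta>" by (simp add: in_keys_iff)
  finally show "Poly_Mapping.lookup p \<beta> =
    Poly_Mapping.lookup (\<Sum>\<alpha>\<in>Poly_Mapping.keys p. mconst (Poly_Mapping.lookup p \<alpha>) * mmonom \<alpha>) \<beta>" by simp
qed

text \<open>The monomial case ranges only over exponents of the given \<open>p\<close>, so a
  hypothesis bounding the variables of \<open>p\<close> stays usable there.\<close>

lemma mpoly_monom_induct [case_names monom zero add]:
  assumes "\<And>\<alpha> c. \<alpha> \<in> Poly_Mapping.keys p \<Longrightarrow> P (mconst c * mmonom \<alpha>)"
    and "P 0" and "\<And>p q. P p \<Longrightarrow> P q \<Longrightarrow> P (p + q)"
  shows "P p"
proof -
  have "P (\<Sum>\<alpha>\<in>S. mconst (Poly_Mapping.lookup p \<alpha>) * mmonom \<alpha>)"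
    if "finite S" "S \<subseteq> Poly_Mapping.keys p" for S
    using that by (induction S rule: finite_induct) (auto intro: assms)
  from this[OF finite_keys order_refl] show ?thesis using mpoly_expand[of p] by simp
qed

subsection \<open>Polynomials in the first variables\<close>

lemma polys_in_0 [simp]: "0 \<in> polys_in n"
  by (simp add: polys_in_def)

lemma polys_in_mmonom: "Poly_Mapping.keys \<alpha> \<subseteq> {..<n} \<Longrightarrow> mmonom \<alpha> \<in> polys_in n"
  by (simp add: polys_in_def mmonom_def)

lemma polys_in_mconst [simp]: "mconst c \<in> polys_in n"
  by (simp add: polys_in_def mconst_def)

lemma polys_in_1 [simp]: "1 \<in> polys_in n"
  by (simp add: polys_in_def)

lemma polys_in_mvar: "k < n \<Longrightarrow> mvar k \<in> polys_in n"
  by (simp add: polys_in_def mvar_def)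

lemma polys_in_add: "p \<in> polys_in n \<Longrightarrow> q \<in> polys_in n \<Longrightarrow> p + q \<in> polys_in n"
  using Poly_Mapping.keys_add[of p q] by (fastforce simp: polys_in_def)

lemma polys_in_mult: "p \<in> polys_in n \<Longrightarrow> q \<in> polys_in n \<Longrightarrow> p * q \<in> polys_in n"
  unfolding polys_in_def
proof (intro CollectI ballI)
  fix \<alpha> assume pq: "p \<in> {p. \<forall>\<alpha>\<in>Poly_Mapping.keys p. Poly_Mapping.keys \<alpha> \<subseteq> {..<n}}"
    "q \<in> {p. \<forall>\<alpha>\<in>Poly_Mapping.keys p. Poly_Mapping.keys \<alpha> \<subseteq> {..<n}}"
    and "\<alpha> \<in> Poly_Mapping.keys (p * q)"
  then obtain a b where "\<alpha> = a + b" "a \<in> Poly_Mapping.keys p" "b \<in> Poly_Mapping.keys q"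
    using keys_mult[of p q] by auto
  then show "Poly_Mapping.keys \<alpha> \<subseteq> {..<n}"
    using pq Poly_Mapping.keys_add[of a b] by fastforce
qed

lemma polys_in_uminus: "p \<in> polys_in n \<Longrightarrow> - p \<in> polys_in n"
  by (simp add: polys_in_def)

lemma polys_in_diff: "p \<in> polys_in n \<Longrightarrow> q \<in> polys_in n \<Longrightarrow> p - q \<in> polys_in n"
  using polys_in_add[of p n "- q"] by (simp add: polys_in_uminus)

lemma polys_in_sum: "(\<And>i. i \<in> S \<Longrightarrow> f i \<in> polys_in n) \<Longrightarrow> sum f S \<in> polys_in n"
  by (induction S rule: infinite_finite_induct) (auto intro: polys_in_add)

lemma polys_in_prod: "(\<And>i. i \<in> S \<Longrightarrow> f i \<in> polys_in n) \<Longrightarrow> prod f S \<in> polys_in n"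
  by (induction S rule: infinite_finite_induct) (auto intro: polys_in_mult)

lemma polys_in_power: "p \<in> polys_in n \<Longrightarrow> p ^ k \<in> polys_in n"
  by (induction k) (auto intro: polys_in_mult)

lemma polys_in_of_int: "of_int z \<in> polys_in n"
proof -
  have "of_int z = (mconst (of_int z) :: 'a mpoly)" by (simp add: mconst_def)
  then show ?thesis by simp
qed

lemma polys_in_mono: "n \<le> n' \<Longrightarrow> p \<in> polys_in n \<Longrightarrow> p \<in> polys_in n'"
  unfolding polys_in_def by fastforce

lemmas polys_in_intros = polys_in_0 polys_in_1 polys_in_mconst polys_in_mvar polys_in_add
  polys_in_mult polys_in_uminus polys_in_diff polys_in_sum polys_in_prod polys_in_power
  polys_in_of_int polys_in_mmonom

lemma polys_in_UN: "\<exists>n. p \<in> polys_in n"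
proof -
  have "finite (\<Union>\<alpha>\<in>Poly_Mapping.keys p. Poly_Mapping.keys \<alpha>)" by auto
  then obtain n where "\<forall>k\<in>(\<Union>\<alpha>\<in>Poly_Mapping.keys p. Poly_Mapping.keys \<alpha>). k < n"
    using finite_nat_set_iff_bounded by blast
  then show ?thesis by (intro exI[of _ n]) (auto simp: polys_in_def)
qed

lemma mvar_eq_mmonom: "mvar k = mmonom (Poly_Mapping.single k 1)"
  by (simp add: mvar_def mmonom_def)

lemma mvar_power: "mvar k ^ n = mmonom (Poly_Mapping.single k n)"
  by (induction n) (auto simp: mvar_def mmonom_def mult_single single_add[symmetric])

lemma mmonom_sum: "finite S \<Longrightarrow> mmonom (sum f S) = (\<Prod>i\<in>S. mmonom (f i))"
  by (induction S rule: finite_induct) (auto simp: mmonom_add)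

lemma poly_mapping_sum_single:
  "\<alpha> = (\<Sum>k\<in>Poly_Mapping.keys \<alpha>. Poly_Mapping.single k (Poly_Mapping.lookup \<alpha> k))"
  by (rule poly_mapping_eqI) (simp add: lookup_sum lookup_single when_def in_keys_iff)

lemma mmonom_eq_prod:
  "mmonom \<alpha> = (\<Prod>k\<in>Poly_Mapping.keys \<alpha>. mvar k ^ Poly_Mapping.lookup \<alpha> k)"
  by (subst poly_mapping_sum_single[of \<alpha>]) (simp add: mmonom_sum mvar_power)

text \<open>Induction along the ring generators, suited to maps that respect sums and obey a product
  rule: substitutions, derivatives, divided differences.\<close>

lemma polys_in_induct [consumes 1, case_names const var add mult]:
  assumes "p \<in> polys_in n"
    and const: "\<And>c. P (mconst c)" and var: "\<And>k. k < n \<Longrightarrow> P (mvar k)"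
    and add: "\<And>p q. p \<in> polys_in n \<Longrightarrow> q \<in> polys_in n \<Longrightarrow> P p \<Longrightarrow> P q \<Longrightarrow> P (p + q)"
    and mult: "\<And>p q. p \<in> polys_in n \<Longrightarrow> q \<in> polys_in n \<Longrightarrow> P p \<Longrightarrow> P q \<Longrightarrow> P (p * q)"
  shows "P p"
proof -
  have pow: "P (mvar k ^ i)" if "k < n" for k i
  proof (induction i)
    case 0 then show ?case using const[of 1] by simp
  next
    case (Suc i) then show ?case using that by (auto intro: mult var polys_in_intros)
  qed
  have mon: "P (\<Prod>k\<in>S. mvar k ^ e k)" if "finite S" "S \<subseteq> {..<n}" for S e
    using that
  proof (induction S rule: finite_induct)
    case empty then show ?case using const[of 1] by simp
  next
    case (insert x F)
    then show ?case by (auto intro!: mult pow polys_in_intros)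
  qed
  \<comment> \<open>Membership is carried along because the case \<open>add\<close> needs it for
    both summands.\<close>
  have "p \<in> polys_in n \<and> P p"
  proof (induction p rule: mpoly_monom_induct)
    case (monom \<alpha> c)
    then have k: "Poly_Mapping.keys \<alpha> \<subseteq> {..<n}" using assms(1) by (auto simp: polys_in_def)
    then have "P (mmonom \<alpha>)" using mon[OF finite_keys k] by (simp add: mmonom_eq_prod)
    then show ?case using k by (auto intro!: mult const polys_in_intros)
  next
    case zero then show ?case using const[of 0] by simp
  qed (auto intro: add polys_in_add)
  then show ?thesis by simp
qed

subsection \<open>Substitution and partial derivatives\<close>

lemma msubst_lin_ext:
  "msubst \<sigma> = lin_ext (\<lambda>\<alpha>. \<Prod>k\<in>Poly_Mapping.keys \<alpha>. \<sigma> k ^ Poly_Mapping.lookup \<alpha> k)"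
  by (rule ext) (simp add: msubst_def lin_ext_def)

lemma msubst_0 [simp]: "msubst \<sigma> 0 = 0"
  by (simp add: msubst_lin_ext)

lemma msubst_add: "msubst \<sigma> (p + q) = msubst \<sigma> p + msubst \<sigma> q"
  by (simp add: msubst_lin_ext lin_ext_add)

lemma msubst_diff: "msubst \<sigma> (p - q) = msubst \<sigma> p - msubst \<sigma> q"
  by (simp add: msubst_lin_ext lin_ext_diff)

lemma msubst_sum: "msubst \<sigma> (sum f S) = (\<Sum>i\<in>S. msubst \<sigma> (f i))"
  by (simp add: msubst_lin_ext lin_ext_sum)

lemma msubst_mconst_mult: "msubst \<sigma> (mconst c * p) = mconst c * msubst \<sigma> p"
  by (simp add: msubst_lin_ext lin_ext_mconst_mult)

lemma msubst_mmonom: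
  "msubst \<sigma> (mmonom \<alpha>) = (\<Prod>k\<in>Poly_Mapping.keys \<alpha>. \<sigma> k ^ Poly_Mapping.lookup \<alpha> k)"
  by (simp add: msubst_lin_ext lin_ext_monom)

lemma msubst_mmonom_superset:
  assumes "finite S" "Poly_Mapping.keys \<alpha> \<subseteq> S"
  shows "msubst \<sigma> (mmonom \<alpha>) = (\<Prod>k\<in>S. \<sigma> k ^ Poly_Mapping.lookup \<alpha> k)"
  unfolding msubst_mmonom
  by (rule prod.mono_neutral_left) (use assms in \<open>auto simp: in_keys_iff\<close>)

lemma msubst_1 [simp]: "msubst \<sigma> 1 = 1"
  using msubst_mmonom[of \<sigma> 0] by simp

lemma msubst_mconst [simp]: "msubst \<sigma> (mconst c) = mconst c"
  using msubst_mconst_mult[of \<sigma> c 1] by simp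

lemma msubst_mvar [simp]: "msubst \<sigma> (mvar k) = \<sigma> k"
  by (simp add: mvar_eq_mmonom msubst_mmonom)

lemma msubst_mult: "msubst \<sigma> (p * q) = msubst \<sigma> p * msubst \<sigma> q"
proof (induction p rule: mpoly_monom_induct)
  case (monom \<alpha> c)
  show ?case
  proof (induction q rule: mpoly_monom_induct)
    case (monom \<beta> d)
    let ?S = "Poly_Mapping.keys \<alpha> \<union> Poly_Mapping.keys \<beta>"
    have "msubst \<sigma> (mmonom (\<alpha> + \<beta>)) = (\<Prod>k\<in>?S. \<sigma> k ^ Poly_Mapping.lookup (\<alpha> + \<beta>) k)"
      by (rule msubst_mmonom_superset) (use Poly_Mapping.keys_add[of \<alpha> \<beta>] in auto)
    also have "\<dots> = msubst \<sigma> (mmonom \<alpha>) * msubst \<sigma> (mmonom \<beta>)"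
      by (simp add: msubst_mmonom_superset[of ?S] lookup_add power_add prod.distrib)
    finally have *: "msubst \<sigma> (mmonom \<alpha> * mmonom \<beta>) = msubst \<sigma> (mmonom \<alpha>) * msubst \<sigma> (mmonom \<beta>)"
      by (simp add: mmonom_add)
    have "mconst c * mmonom \<alpha> * (mconst d * mmonom \<beta>) = mconst c * (mconst d * (mmonom \<alpha> * mmonom \<beta>))"
      by (simp add: mult_ac)
    then show ?case by (simp add: msubst_mconst_mult * mult_ac)
  qed (auto simp: msubst_add algebra_simps)
qed (auto simp: msubst_add algebra_simps)

lemma msubst_power: "msubst \<sigma> (p ^ k) = msubst \<sigma> p ^ k"
  by (induction k) (auto simp: msubst_mult)

lemma comm_ring_hom_msubst: "comm_ring_hom (msubst \<sigma>)"
  by unfold_locales (auto simp: msubst_add msubst_mult)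

lemma msubst_polys_in:
  assumes "p \<in> polys_in m" "\<And>k. k < m \<Longrightarrow> \<sigma> k \<in> polys_in n"
  shows "msubst \<sigma> p \<in> polys_in n"
  using assms(1)
  by (induction rule: polys_in_induct)
     (auto simp: msubst_add msubst_mult assms(2) intro: polys_in_intros)

lemma msubst_cong:
  assumes "p \<in> polys_in m" "\<And>k. k < m \<Longrightarrow> \<sigma> k = \<rho> k"
  shows "msubst \<sigma> p = msubst \<rho> p"
  using assms(1)
  by (induction rule: polys_in_induct) (auto simp: msubst_add msubst_mult assms(2))

lemma msubst_mvar_id: "msubst mvar p = p"
proof -
  obtain n where "p \<in> polys_in n" using polys_in_UN by blast
  then show ?thesis
    by (induction rule: polys_in_induct) (auto simp: msubst_add msubst_mult)
qed

lemma msubst_msubst: "msubst \<sigma> (msubst \<rho> p) = msubst (\<lambda>k. msubst \<sigma> (\<rho> k)) p"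
proof -
  obtain n where "p \<in> polys_in n" using polys_in_UN by blast
  then show ?thesis
    by (induction rule: polys_in_induct) (auto simp: msubst_add msubst_mult)
qed

text \<open>Subtraction of exponents is truncated; it truncates only where the exponent of variable
  \<open>k\<close> is 0, and there the coefficient is 0.\<close>

definition monom_deriv :: "nat \<Rightarrow> (nat \<Rightarrow>\<^sub>0 nat) \<Rightarrow> 'a::comm_ring_1 mpoly" where
  "monom_deriv k \<alpha> =
     Poly_Mapping.single (\<alpha> - Poly_Mapping.single k 1) (of_nat (Poly_Mapping.lookup \<alpha> k))"

lemma mpderiv_lin_ext: "mpderiv k = lin_ext (monom_deriv k)"
  by (rule ext) (simp add: mpderiv_def lin_ext_def monom_deriv_def mconst_single mult.commute)

lemma monom_deriv_eq_0: "Poly_Mapping.lookup \<alpha> k = 0 \<Longrightarrow> monom_deriv k \<alpha> = 0"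
  by (simp add: monom_deriv_def)

text \<open>With the other monomial moved inside the truncated difference, both terms of the Leibniz
  rule sit at the same exponent and only their coefficients add.\<close>

lemma mmonom_monom_deriv:
  "mmonom \<beta> * monom_deriv k \<alpha> =
     Poly_Mapping.single (\<beta> + \<alpha> - Poly_Mapping.single k 1) (of_nat (Poly_Mapping.lookup \<alpha> k))"
proof (cases "Poly_Mapping.lookup \<alpha> k = 0")
  case True
  then show ?thesis by (simp add: monom_deriv_eq_0)
next
  case False
  have "\<beta> + (\<alpha> - Poly_Mapping.single k 1) = \<beta> + \<alpha> - Poly_Mapping.single k 1"
    by (rule poly_mapping_eqI) (use False in \<open>auto simp: lookup_add lookup_minus lookup_single when_def\<close>)
  then show ?thesis by (simp add: monom_deriv_def mmonom_def mult_single)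
qed

lemma monom_deriv_add:
  "monom_deriv k (\<alpha> + \<beta>) = monom_deriv k \<alpha> * mmonom \<beta> + mmonom \<alpha> * monom_deriv k \<beta>"
proof -
  have "monom_deriv k (\<alpha> + \<beta>) = (mmonom \<beta> * monom_deriv k \<alpha> + mmonom \<alpha> * monom_deriv k \<beta> :: 'a mpoly)"
    unfolding mmonom_monom_deriv by (simp add: add.commute[of \<beta>] monom_deriv_def lookup_add single_add)
  then show ?thesis by (simp add: mult.commute)
qed

lemma mpderiv_add: "mpderiv k (p + q) = mpderiv k p + mpderiv k q"
  by (simp add: mpderiv_lin_ext lin_ext_add)

lemma mpderiv_mult: "mpderiv k (p * q) = mpderiv k p * q + p * mpderiv k q"
proof (induction p rule: mpoly_monom_induct)
  case (monom \<alpha> c)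
  show ?case
  proof (induction q rule: mpoly_monom_induct)
    case (monom \<beta> d)
    have "mconst c * mmonom \<alpha> * (mconst d * mmonom \<beta>) = mconst c * (mconst d * mmonom (\<alpha> + \<beta>))"
      by (simp add: mult_ac mmonom_add)
    then show ?case
      by (simp add: mpderiv_lin_ext lin_ext_mconst_mult lin_ext_monom monom_deriv_add algebra_simps)
  qed (auto simp: mpderiv_lin_ext lin_ext_add algebra_simps)
qed (auto simp: mpderiv_lin_ext lin_ext_add algebra_simps)

lemma mpderiv_mconst [simp]: "mpderiv k (mconst c) = 0"
  by (simp add: mpderiv_def mconst_def)

lemma mpderiv_mvar: "mpderiv k (mvar l) = (if l = k then 1 else 0)"
  by (simp add: mvar_eq_mmonom mpderiv_lin_ext lin_ext_monom monom_deriv_def lookup_single when_def)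

lemma polys_in_mpderiv: "p \<in> polys_in n \<Longrightarrow> mpderiv k p \<in> polys_in n"
  by (induction rule: polys_in_induct)
     (auto simp: mpderiv_add mpderiv_mult mpderiv_mvar intro: polys_in_intros)

subsection \<open>Traces and nilpotent matrices\<close>

text \<open>An eigenvector exists over an algebraically closed field. Conjugating by a basis that
  starts with it clears the first column below the diagonal, and the lower right block is handled by
  induction.\<close>

lemma triangularizable:
  fixes A :: "'a::alg_closed_field mat"
  assumes "A \<in> carrier_mat n n"
  shows "\<exists>B\<in>carrier_mat n n. upper_triangular B \<and> similar_mat A B"
  using assms
proof (induction n arbitrary: A)
  case 0
  then show ?case by (intro bexI[of _ A] conjI similar_mat_refl upper_triangularI) auto
next
  case (Suc n A)
  note A = Suc.prems
  let ?N = "Suc n"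
  have "degree (char_poly A) = ?N" using degree_monic_char_poly[OF A] by simp
  then obtain e where "poly (char_poly A) e = 0"
    using alg_closed_imp_poly_has_root[of "char_poly A"] by auto
  then have "eigenvalue A e" using eigenvalue_root_char_poly[OF A] by simp
  then obtain v where v: "v \<in> carrier_vec ?N" and v0: "v \<noteq> 0\<^sub>v ?N" and Av: "A *\<^sub>v v = e \<cdot>\<^sub>v v"
    unfolding eigenvalue_def eigenvector_def using A by auto
  interpret vec_space "TYPE('a)" ?N .
  define b where "b = basis_completion v"
  note bc = basis_completion[OF v v0, folded b_def]
  define W where "W = mat_of_cols ?N b"
  have W: "W \<in> carrier_mat ?N ?N" unfolding W_def using bc(6) by (metis mat_of_cols_carrier(1))
  have colsW: "cols W = b" unfolding W_def using bc(2) by (intro cols_mat_of_cols) auto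
  have "rank W = ?N" by (rule lin_indpt_full_rank[OF W]) (use colsW bc in auto)
  then have "det W \<noteq> 0" using det_rank_iff[OF W] by simp
  then obtain W' where W': "W' \<in> carrier_mat ?N ?N" and WW': "W * W' = 1\<^sub>m ?N" and W'W: "W' * W = 1\<^sub>m ?N"
    using det_non_zero_imp_unit[OF W, of "()"] unfolding Units_def ring_mat_def by auto
  have colW: "col W 0 = v"
  proof -
    have "col W 0 = b ! 0" using colsW W
      by (metis W_def bc(2) bc(6) col_mat_of_cols hd_conv_nth nth_mem subsetD zero_less_Suc)
    also have "\<dots> = v" using bc(6,7) by (metis hd_conv_nth length_0_conv nat.distinct(1))
    finally show ?thesis .
  qed
  define A' where "A' = W' * A * W"
  have A': "A' \<in> carrier_mat ?N ?N" unfolding A'_def using W W' A by auto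
  have simAA': "similar_mat A A'"
  proof (rule similar_matI[of A A' W W' ?N])
    show "A = W * A' * W'" unfolding A'_def
    proof -
      have "W * (W' * A * W) * W' = W * (W' * A) * (W * W')"
        using W W' A by (simp add: assoc_mult_mat[of _ ?N ?N _ ?N _ ?N])
      also have "W * (W' * A) = (W * W') * A"
        using W W' A by (simp add: assoc_mult_mat[of _ ?N ?N _ ?N _ ?N])
      finally have "W * (W' * A * W) * W' = (W * W') * A * (W * W')" .
      then show "A = W * (W' * A * W) * W'" using WW' A by simp
    qed
  qed (use W W' A A' WW' W'W in auto)
  \<comment> \<open>\<open>v\<close> is column 0 of \<open>W\<close>, so the inverse sends it to the
    first unit vector; this is what makes column 0 of \<open>A'\<close> a multiple of that
    vector.\<close>
  have W'v: "W' *\<^sub>v v = unit_vec ?N 0"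
  proof -
    have "W' *\<^sub>v col W 0 = col (W' * W) 0" using col_mult2[OF W' W, of 0] by simp
    then show ?thesis using W'W colW by simp
  qed
  have "col A' 0 = (W' * A) *\<^sub>v v"
    unfolding A'_def using col_mult2[of "W' * A" ?N ?N W ?N 0] W' A W colW by auto
  also have "\<dots> = W' *\<^sub>v (e \<cdot>\<^sub>v v)" using Av W' A v by (metis assoc_mult_mat_vec)
  also have "\<dots> = e \<cdot>\<^sub>v unit_vec ?N 0" using W'v W' v by (simp add: mult_mat_vec)
  finally have col0: "col A' 0 = e \<cdot>\<^sub>v unit_vec ?N 0" .
  obtain A1 A2 A0 A3 where spl: "split_block A' 1 1 = (A1,A2,A0,A3)"
    by (cases "split_block A' 1 1", auto)
  have dims: "dim_row A' = 1 + n" "dim_col A' = 1 + n" using A' by auto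
  note sb = split_block[OF spl dims]
  have A0: "A0 = 0\<^sub>m n 1"
  proof (rule eq_matI)
    fix i j assume ij: "i < dim_row (0\<^sub>m n 1)" "j < dim_col (0\<^sub>m n 1)"
    have "A' $$ (Suc i, 0) = col A' 0 $ Suc i" using A' ij by simp
    also have "\<dots> = 0" unfolding col0 using ij by simp
    finally have "A' $$ (Suc i, 0) = 0" .
    moreover have "A0 $$ (i, j) = A' $$ (Suc i, 0)"
      using spl ij A' unfolding split_block_def Let_def by auto
    ultimately show "A0 $$ (i, j) = 0\<^sub>m n 1 $$ (i, j)" using ij by simp
  qed (use sb in auto)
  obtain B where B: "B \<in> carrier_mat n n" "upper_triangular B" "similar_mat A3 B"
    using Suc.IH[OF sb(4)] by auto
  \<comment> \<open>Triangularizing the lower right block changes the upper right one, hence the new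
    \<open>B0\<close>.\<close>
  obtain B0 where B0: "B0 \<in> carrier_mat 1 n" and
    sim: "similar_mat (four_block_mat A1 A2 (0\<^sub>m n 1) A3) (four_block_mat A1 B0 (0\<^sub>m n 1) B)"
    using similar_mat_four_block_0_ex[OF similar_mat_refl[OF sb(1)] B(3) sb(2) sb(1) sb(4)] by auto
  let ?B = "four_block_mat A1 B0 (0\<^sub>m n 1) B"
  have "similar_mat A ?B"
    using simAA' sim sb(5) A0 by (metis similar_mat_trans)
  moreover have "upper_triangular ?B"
    by (rule upper_triangular_four_block[OF sb(1) B(1) _ B(2)]) (use sb(1) in auto)
  moreover have "?B \<in> carrier_mat ?N ?N" using sb(1) B(1)
    by (metis One_nat_def four_block_carrier_mat plus_1_eq_Suc)
  ultimately show ?case by blast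
qed

definition mat_trace :: "'a::comm_ring_1 mat \<Rightarrow> 'a" where
  "mat_trace A = (\<Sum>i<dim_row A. A $$ (i, i))"

lemma mat_trace_mult_commute:
  assumes "A \<in> carrier_mat n k" "B \<in> carrier_mat k n"
  shows "mat_trace (A * B) = mat_trace (B * A)"
proof -
  have "mat_trace (A * B) = (\<Sum>i<n. \<Sum>j<k. A $$ (i, j) * B $$ (j, i))"
    using assms by (simp add: mat_trace_def scalar_prod_def atLeast0LessThan)
  also have "\<dots> = (\<Sum>j<k. \<Sum>i<n. B $$ (j, i) * A $$ (i, j))"
    by (subst sum.swap) (simp add: mult.commute)
  also have "\<dots> = mat_trace (B * A)"
    using assms by (simp add: mat_trace_def scalar_prod_def atLeast0LessThan)
  finally show ?thesis .
qed

lemma mat_trace_similar: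
  assumes "similar_mat A B"
  shows "mat_trace A = mat_trace B"
proof -
  obtain n P Q where c: "{A, B, P, Q} \<subseteq> carrier_mat n n" and
    PQ: "P * Q = 1\<^sub>m n" "Q * P = 1\<^sub>m n" "A = P * B * Q"
    using similar_matD[OF assms] by blast
  have "mat_trace A = mat_trace (Q * (P * B))"
    unfolding PQ(3) by (rule mat_trace_mult_commute) (use c in auto)
  also have "Q * (P * B) = B" using c PQ(2)
    by (metis assoc_mult_mat insert_subset left_mult_one_mat)
  finally show ?thesis .
qed

lemma pow_mat_Suc_index:
  assumes "A \<in> carrier_mat n n" "i < n" "j < n"
  shows "(A ^\<^sub>m Suc k) $$ (i, j) = (\<Sum>l<n. (A ^\<^sub>m k) $$ (i, l) * A $$ (l, j))"
proof -
  have "A ^\<^sub>m k \<in> carrier_mat n n" using assms by simp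
  then show ?thesis using assms by (simp add: scalar_prod_def atLeast0LessThan)
qed

text \<open>In the sum for entry (i, j) with j \<le> i, the terms l < i vanish by induction and the
  terms l > i because \<open>A\<close> is upper triangular; only l = i is left.\<close>

lemma upper_triangular_pow:
  assumes "A \<in> carrier_mat n n" "upper_triangular A" "i < n" "j \<le> i"
  shows "(A ^\<^sub>m k) $$ (i, j) = (if j = i then A $$ (i, i) ^ k else 0)"
  using assms(3,4)
proof (induction k arbitrary: i j)
  case 0
  then show ?case using assms(1) by auto
next
  case (Suc k)
  have "(A ^\<^sub>m Suc k) $$ (i, j) = (\<Sum>l<n. (A ^\<^sub>m k) $$ (i, l) * A $$ (l, j))"
    using Suc assms(1) by (intro pow_mat_Suc_index) auto
  also have "\<dots> = (\<Sum>l<n. if l = i then A $$ (i, i) ^ k * A $$ (i, j) else 0)"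
  proof (rule sum.cong[OF refl])
    fix l assume l: "l \<in> {..<n}"
    show "(A ^\<^sub>m k) $$ (i, l) * A $$ (l, j) = (if l = i then A $$ (i, i) ^ k * A $$ (i, j) else 0)"
    proof (cases "l \<le> i")
      case True
      then show ?thesis using Suc.IH[of i l] Suc.prems by auto
    next
      case False
      then have "A $$ (l, j) = 0" using assms(1,2) Suc.prems l by (auto intro: upper_triangularD)
      then show ?thesis using False by auto
    qed
  qed
  also have "\<dots> = A $$ (i, i) ^ k * A $$ (i, j)" using Suc.prems by simp
  also have "\<dots> = (if j = i then A $$ (i, i) ^ Suc k else 0)"
  proof (cases "j = i")
    case False
    then have "A $$ (i, j) = 0" using Suc.prems assms(1,2) by (intro upper_triangularD) auto
    then show ?thesis using False by simp
  qed (simp add: power_commutes)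
  finally show ?case .
qed

text \<open>Each further factor pushes the possibly nonzero entries one superdiagonal up, so the
  \<open>n\<close>-th power is zero.\<close>

lemma strictly_upper_triangular_pow:
  assumes "A \<in> carrier_mat n n" "upper_triangular A" "\<And>i. i < n \<Longrightarrow> A $$ (i, i) = 0"
    and "i < n" "j < n" "j < i + k"
  shows "(A ^\<^sub>m k) $$ (i, j) = 0"
  using assms(4-)
proof (induction k arbitrary: i j)
  case 0
  then show ?case using assms(1) by auto
next
  case (Suc k)
  have "(A ^\<^sub>m Suc k) $$ (i, j) = (\<Sum>l<n. (A ^\<^sub>m k) $$ (i, l) * A $$ (l, j))"
    using Suc assms(1) by (intro pow_mat_Suc_index) auto
  also have "\<dots> = 0"
  proof (rule sum.neutral, rule ballI)
    fix l assume l: "l \<in> {..<n}"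
    show "(A ^\<^sub>m k) $$ (i, l) * A $$ (l, j) = 0"
    proof (cases "l < i + k")
      case True
      then show ?thesis using Suc.IH[of i l] Suc.prems l by auto
    next
      case False
      then have "j \<le> l" using Suc.prems by simp
      then have "A $$ (l, j) = 0" using assms(1,2,3) Suc.prems l
        by (cases "j = l") (auto intro: upper_triangularD)
      then show ?thesis by simp
    qed
  qed
  finally show ?case .
qed

text \<open>Take \<open>q\<close> vanishing at every value of \<open>b\<close> except
  \<open>b i\<close>. The sum of \<open>b j * poly q (b j)\<close> is a combination of power sums
  with positive exponents, hence 0, and it is also the multiplicity of \<open>b i\<close> times
  \<open>b i * poly q (b i)\<close>. In characteristic zero the multiplicity stays nonzero in the
  field.\<close>

lemma power_sums_zero:
  fixes b :: "nat \<Rightarrow> 'a::field_char_0"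
  assumes "\<And>k. k > 0 \<Longrightarrow> (\<Sum>i<n. b i ^ k) = 0" and "i < n"
  shows "b i = 0"
proof (rule ccontr)
  assume bi: "b i \<noteq> 0"
  define q where "q = (\<Prod>c\<in>b ` {..<n} - {b i}. [:- c, 1:])"
  have q0: "poly q (b j) = 0" if "j < n" "b j \<noteq> b i" for j
    unfolding q_def poly_prod using that by (intro prod_zero) auto
  have qi: "poly q (b i) \<noteq> 0" unfolding q_def poly_prod by auto
  have "(\<Sum>j<n. b j * poly q (b j)) = (\<Sum>j<n. \<Sum>k\<le>degree q. coeff q k * b j ^ Suc k)"
    by (simp add: poly_altdef sum_distrib_left mult_ac)
  also have "\<dots> = (\<Sum>k\<le>degree q. coeff q k * (\<Sum>j<n. b j ^ Suc k))"
    by (subst sum.swap) (simp add: sum_distrib_left)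
  also have "\<dots> = 0" by (intro sum.neutral ballI) (simp only: assms(1)[OF zero_less_Suc] mult_zero_right)
  finally have "0 = (\<Sum>j<n. b j * poly q (b j))" by simp
  also have "\<dots> = (\<Sum>j\<in>{j\<in>{..<n}. b j = b i}. b j * poly q (b j))"
    by (rule sum.mono_neutral_right) (use q0 in auto)
  also have "\<dots> = (\<Sum>j\<in>{j\<in>{..<n}. b j = b i}. b i * poly q (b i))"
    by (rule sum.cong) auto
  also have "\<dots> = of_nat (card {j\<in>{..<n}. b j = b i}) * (b i * poly q (b i))" by simp
  finally have "card {j\<in>{..<n}. b j = b i} = 0" using bi qi by simp
  then show False using assms(2) by auto
qed

text \<open>On a triangular form, the \<open>k\<close>-th powers of the diagonal entries are
  diagonal entries of the zero matrix, so the diagonal is zero.\<close>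

lemma nilpotent_mat_trace:
  fixes A :: "'a::alg_closed_field mat"
  assumes A: "A \<in> carrier_mat n n" and nil: "A ^\<^sub>m k = 0\<^sub>m n n"
  shows "mat_trace A = 0"
proof -
  obtain B where B: "B \<in> carrier_mat n n" "upper_triangular B" "similar_mat A B"
    using triangularizable[OF A] by auto
  obtain P Q where wit: "similar_mat_wit B A P Q"
    using similar_mat_sym[OF B(3)] unfolding similar_mat_def by auto
  have PQ: "P \<in> carrier_mat n n" "Q \<in> carrier_mat n n" using similar_mat_witD2[OF B(1) wit] by auto
  have Bk: "B ^\<^sub>m k = 0\<^sub>m n n"
    using similar_mat_wit_pow_id[OF wit, of k] nil PQ by simp
  have "B $$ (i, i) = 0" if "i < n" for i
    using upper_triangular_pow[OF B(1,2) that order_refl, of k] that Bk by simp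
  then have "mat_trace B = 0" using B(1) by (simp add: mat_trace_def)
  then show ?thesis using mat_trace_similar[OF B(3)] by simp
qed

text \<open>Traces of powers are power sums of the diagonal of a triangular form; by
  \<open>power_sums_zero\<close> this diagonal is zero, so the form is strictly triangular.\<close>

lemma trace_pow_zero_imp_nilpotent:
  fixes A :: "'a::{alg_closed_field, field_char_0} mat"
  assumes A: "A \<in> carrier_mat n n" and tr: "\<And>k. k > 0 \<Longrightarrow> mat_trace (A ^\<^sub>m k) = 0"
  shows "A ^\<^sub>m n = 0\<^sub>m n n"
proof -
  obtain B where B: "B \<in> carrier_mat n n" "upper_triangular B" "similar_mat A B"
    using triangularizable[OF A] by auto
  obtain P Q where wit: "similar_mat_wit A B P Q"
    using B(3) unfolding similar_mat_def by auto
  have PQ: "P \<in> carrier_mat n n" "Q \<in> carrier_mat n n" using similar_mat_witD2[OF A wit] by auto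
  have "(\<Sum>i<n. (B $$ (i, i)) ^ k) = 0" if "k > 0" for k
  proof -
    have "similar_mat (A ^\<^sub>m k) (B ^\<^sub>m k)"
      using similar_mat_wit_pow[OF wit, of k] unfolding similar_mat_def by auto
    then have "mat_trace (B ^\<^sub>m k) = 0" using mat_trace_similar tr[OF that] by metis
    then show ?thesis
      using B(1) upper_triangular_pow[OF B(1,2) _ order_refl, of _ k] by (simp add: mat_trace_def)
  qed
  then have d: "B $$ (i, i) = 0" if "i < n" for i
    using power_sums_zero[of "\<lambda>i. B $$ (i, i)" n] that by blast
  have "B ^\<^sub>m n = 0\<^sub>m n n"
    by (rule eq_matI) (use B(1) strictly_upper_triangular_pow[OF B(1,2) d] in auto)
  then show ?thesis using similar_mat_wit_pow_id[OF wit, of n] PQ by simp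
qed

subsection \<open>Determinants modulo ideals\<close>

text \<open>Coefficients range over the whole ring, unlike in \<open>gen_ideal\<close>; the bound
  \<open>n\<close> allows speaking of the ideals of initial segments of one family.\<close>

definition fam_ideal :: "nat \<Rightarrow> (nat \<Rightarrow> 'b::comm_ring_1) \<Rightarrow> 'b set" where
  "fam_ideal n w = range (\<lambda>c. \<Sum>i<n. c i * w i)"

lemma fam_idealI: "(\<Sum>i<n. c i * w i) \<in> fam_ideal n w"
  by (auto simp: fam_ideal_def)

lemma fam_ideal_0: "0 \<in> fam_ideal n w"
  using fam_idealI[of "\<lambda>_. 0" w n] by simp

lemma fam_ideal_add: "a \<in> fam_ideal n w \<Longrightarrow> b \<in> fam_ideal n w \<Longrightarrow> a + b \<in> fam_ideal n w"
proof -
  assume "a \<in> fam_ideal n w" "b \<in> fam_ideal n w"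
  then obtain c d where "a = (\<Sum>i<n. c i * w i)" "b = (\<Sum>i<n. d i * w i)"
    by (auto simp: fam_ideal_def)
  then have "a + b = (\<Sum>i<n. (c i + d i) * w i)" by (simp add: distrib_right sum.distrib)
  then show ?thesis using fam_idealI by metis
qed

lemma fam_ideal_mult: "a \<in> fam_ideal n w \<Longrightarrow> r * a \<in> fam_ideal n w"
proof -
  assume "a \<in> fam_ideal n w"
  then obtain c where "a = (\<Sum>i<n. c i * w i)" by (auto simp: fam_ideal_def)
  then have "r * a = (\<Sum>i<n. (r * c i) * w i)" by (simp add: sum_distrib_left mult.assoc)
  then show ?thesis using fam_idealI by metis
qed

lemma fam_ideal_uminus: "a \<in> fam_ideal n w \<Longrightarrow> - a \<in> fam_ideal n w"
  using fam_ideal_mult[of a n w "- 1"] by simp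

lemma fam_ideal_sum: "(\<And>i. i \<in> S \<Longrightarrow> f i \<in> fam_ideal n w) \<Longrightarrow> sum f S \<in> fam_ideal n w"
  by (induction S rule: infinite_finite_induct) (auto intro: fam_ideal_0 fam_ideal_add)

lemma fam_ideal_mem: "i < n \<Longrightarrow> w i \<in> fam_ideal n w"
proof -
  assume i: "i < n"
  have "(\<Sum>j<n. (if j = i then 1 else 0) * w j) = (\<Sum>j<n. if j = i then w j else 0)"
    by (rule sum.cong) auto
  also have "\<dots> = w i" using i by simp
  finally show ?thesis using fam_idealI by metis
qed

lemma prod_diff_in_fam_ideal:
  assumes "finite S" "\<And>i. i \<in> S \<Longrightarrow> f i - g i \<in> fam_ideal n w"
  shows "prod f S - prod g S \<in> fam_ideal n w"
  using assms
proof (induction S rule: finite_induct)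
  case empty
  then show ?case by (simp add: fam_ideal_0)
next
  case (insert x F)
  have "prod f (insert x F) - prod g (insert x F) = prod f F * (f x - g x) + g x * (prod f F - prod g F)"
    using insert by (simp add: algebra_simps)
  also have "\<dots> \<in> fam_ideal n w" using insert by (intro fam_ideal_add fam_ideal_mult) auto
  finally show ?case .
qed

text \<open>By the Leibniz formula the determinant is a polynomial in the entries, so it respects
  congruences of the entries.\<close>

lemma det_diff_in_fam_ideal:
  assumes A: "A \<in> carrier_mat m m" and B: "B \<in> carrier_mat m m"
    and "\<And>i j. i < m \<Longrightarrow> j < m \<Longrightarrow> A $$ (i, j) - B $$ (i, j) \<in> fam_ideal n w"
  shows "det A - det B \<in> fam_ideal n w"
proof -
  have "det A - det B = (\<Sum>p | p permutes {0..<m}. signof p *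
      ((\<Prod>i = 0..<m. A $$ (i, p i)) - (\<Prod>i = 0..<m. B $$ (i, p i))))"
    unfolding det_def'[OF A] det_def'[OF B] by (simp add: sum_subtractf right_diff_distrib)
  also have "\<dots> \<in> fam_ideal n w"
  proof (intro fam_ideal_sum fam_ideal_mult prod_diff_in_fam_ideal)
    fix p i assume "p \<in> {p. p permutes {0..<m}}" "i \<in> {0..<m}"
    then have "i < m" "p i < m" using permutes_in_image[of p "{0..<m}" i] by auto
    then show "A $$ (i, p i) - B $$ (i, p i) \<in> fam_ideal n w" by (rule assms(3))
  qed simp
  finally show ?thesis .
qed

section \<open>Regular sequences and Koszul relations\<close>

definition regular_seq :: "nat \<Rightarrow> (nat \<Rightarrow> 'b::comm_ring_1) \<Rightarrow> bool" where
  "regular_seq n v \<longleftrightarrow> (\<forall>k<n. \<forall>r. r * v k \<in> fam_ideal k v \<longrightarrow> r \<in> fam_ideal k v)"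

text \<open>The syzygies of a regular sequence are generated by the Koszul relations.\<close>

lemma syzygy_combination_in_fam_ideal:
  assumes "regular_seq n v" "(\<Sum>a<n. r a * v a) = 0"
    and "\<And>a b. a < n \<Longrightarrow> b < n \<Longrightarrow> v b * C a - v a * C b \<in> fam_ideal N w"
  shows "(\<Sum>a<n. r a * C a) \<in> fam_ideal N w"
  using assms
proof (induction n arbitrary: r)
  case 0
  then show ?case by (simp add: fam_ideal_0)
next
  case (Suc n)
  have "r n * v n = (\<Sum>a<n. (- r a) * v a)"
    using Suc.prems(2) by (simp add: sum_negf eq_neg_iff_add_eq_0 add.commute)
  then have "r n * v n \<in> fam_ideal n v" using fam_idealI by metis
  then have "r n \<in> fam_ideal n v" using Suc.prems(1) by (auto simp: regular_seq_def)
  then obtain c where c: "r n = (\<Sum>a<n. c a * v a)" by (auto simp: fam_ideal_def)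
  \<comment> \<open>Subtracting \<open>c a\<close> times the Koszul relation between
    \<open>v a\<close> and \<open>v n\<close>, for all a < n, removes the last coefficient and
    leaves a syzygy of the first \<open>n\<close> elements.\<close>
  have "(\<Sum>a<n. (r a + c a * v n) * v a) = (\<Sum>a<n. r a * v a) + (\<Sum>a<n. c a * v a) * v n"
    by (simp add: algebra_simps sum.distrib sum_distrib_left)
  also have "\<dots> = 0" using Suc.prems(2) c by simp
  finally have "(\<Sum>a<n. (r a + c a * v n) * v a) = 0" .
  then have "(\<Sum>a<n. (r a + c a * v n) * C a) \<in> fam_ideal N w"
    using Suc.prems by (intro Suc.IH) (auto simp: regular_seq_def)
  moreover have "(\<Sum>a<n. c a * (v a * C n - v n * C a)) \<in> fam_ideal N w"
    using Suc.prems(3) by (intro fam_ideal_sum fam_ideal_mult) auto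
  moreover have "(\<Sum>a<Suc n. r a * C a) =
      (\<Sum>a<n. (r a + c a * v n) * C a) + (\<Sum>a<n. c a * (v a * C n - v n * C a))"
    by (simp add: c algebra_simps sum.distrib sum_subtractf sum_distrib_left)
  ultimately show ?case by (simp only: fam_ideal_add)
qed

text \<open>Deleting row \<open>k\<close> removes the only row in which the matrices may
  differ.\<close>

lemma cofactor_cong_row:
  assumes "A \<in> carrier_mat n n" "B \<in> carrier_mat n n" "k < n" "j < n"
    and "\<And>i j. i < n \<Longrightarrow> j < n \<Longrightarrow> i \<noteq> k \<Longrightarrow> A $$ (i, j) = B $$ (i, j)"
  shows "cofactor A k j = cofactor B k j"
proof -
  have "mat_delete A k j = mat_delete B k j"
    unfolding mat_delete_def using assms by (intro eq_matI) auto
  then show ?thesis by (simp add: cofactor_def)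
qed

text \<open>This is entry (b, j) of the identity saying that the adjugate times \<open>A\<close> is
  \<open>det A\<close> times the unit matrix.\<close>

lemma sum_cofactor_mult:
  assumes A: "A \<in> carrier_mat n n" and "b < n" "j < n"
  shows "(\<Sum>i<n. cofactor A i b * A $$ (i, j)) = (if b = j then det A else 0)"
proof -
  have "(adj_mat A * A) $$ (b, j) = (\<Sum>i<n. cofactor A i b * A $$ (i, j))"
    using assms by (simp add: adj_mat_def scalar_prod_def atLeast0LessThan)
  then show ?thesis using adj_mat(3)[OF A] assms by (cases "b = j") simp_all
qed

text \<open>Cramer's rule for the matrix \<open>P\<close> in which row \<open>k\<close> is replaced
  by the unit vector at \<open>a\<close>. Its determinant is the cofactor at (k, a), its row
  \<open>k\<close> maps \<open>v\<close> to \<open>v a\<close>, and every other row maps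
  \<open>v\<close> into the ideal.\<close>

lemma cofactor_row_koszul:
  assumes A: "A \<in> carrier_mat n n" and k: "k < n" and ab: "a < n" "b < n"
    and w: "\<And>i. i < n \<Longrightarrow> i \<noteq> k \<Longrightarrow> (\<Sum>j<n. A $$ (i, j) * v j) = w i"
  shows "v b * cofactor A k a - v a * cofactor A k b \<in> fam_ideal n w"
proof -
  define P where "P = mat n n (\<lambda>(i, j). if i = k then (if j = a then 1 else 0) else A $$ (i, j))"
  have P: "P \<in> carrier_mat n n" by (simp add: P_def)
  have cof: "cofactor P k j = cofactor A k j" if "j < n" for j
    by (rule cofactor_cong_row[OF P A k that]) (auto simp: P_def)
  have "det P = (\<Sum>j<n. P $$ (k, j) * cofactor P k j)"
    by (rule laplace_expansion_row[OF P k])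
  also have "\<dots> = (\<Sum>j<n. if j = a then cofactor A k j else 0)"
    by (rule sum.cong) (use k cof in \<open>auto simp: P_def\<close>)
  also have "\<dots> = cofactor A k a" using ab by simp
  finally have det: "det P = cofactor A k a" .
  define u where "u i = (\<Sum>j<n. P $$ (i, j) * v j)" for i
  have uk: "u k = v a"
  proof -
    have "u k = (\<Sum>j<n. if j = a then v j else 0)"
      unfolding u_def by (rule sum.cong) (use k in \<open>auto simp: P_def\<close>)
    then show ?thesis using ab by simp
  qed
  have ui: "u i = w i" if "i < n" "i \<noteq> k" for i
    using w[OF that] that by (simp add: u_def P_def)
  have "(\<Sum>i<n. cofactor P i b * u i) = (\<Sum>j<n. (\<Sum>i<n. cofactor P i b * P $$ (i, j)) * v j)"
    unfolding u_def sum_distrib_left sum_distrib_right by (subst sum.swap) (simp add: mult.assoc)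
  also have "\<dots> = (\<Sum>j<n. (if b = j then det P else 0) * v j)"
    by (rule sum.cong) (use sum_cofactor_mult[OF P ab(2)] in auto)
  also have "\<dots> = (\<Sum>j<n. if b = j then det P * v j else 0)"
    by (rule sum.cong) auto
  also have "\<dots> = det P * v b" using ab by simp
  finally have "det P * v b = (\<Sum>i<n. cofactor P i b * u i)" by simp
  also have "\<dots> = cofactor P k b * u k + (\<Sum>i\<in>{..<n} - {k}. cofactor P i b * u i)"
    using k by (simp add: sum.remove)
  finally have "v b * cofactor A k a - v a * cofactor A k b = (\<Sum>i\<in>{..<n} - {k}. cofactor P i b * u i)"
    using det cof[OF ab(2)] uk by (simp add: mult.commute)
  also have "\<dots> \<in> fam_ideal n w"
    by (intro fam_ideal_sum fam_ideal_mult) (use ui fam_ideal_mem in auto)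
  finally show ?thesis .
qed

text \<open>The rows of \<open>D\<close> are exchanged for those of \<open>D'\<close> one at a time.
  Each exchange changes the determinant by a row difference paired with cofactors; the difference is
  a syzygy of \<open>v\<close>, and the cofactors satisfy the Koszul relations modulo
  \<open>w\<close>.\<close>

lemma det_diff_of_equal_combination:
  assumes D: "D \<in> carrier_mat n n" and D': "D' \<in> carrier_mat n n" and reg: "regular_seq n v"
    and w: "\<And>i. i < n \<Longrightarrow> (\<Sum>j<n. D $$ (i, j) * v j) = w i"
    and w': "\<And>i. i < n \<Longrightarrow> (\<Sum>j<n. D' $$ (i, j) * v j) = w i"
  shows "det D - det D' \<in> fam_ideal n w"
proof -
  define H where "H k = mat n n (\<lambda>(i, j). if i < k then D' $$ (i, j) else D $$ (i, j))" for k
  have H: "H k \<in> carrier_mat n n" for k by (simp add: H_def)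
  have step: "det (H k) - det (H (Suc k)) \<in> fam_ideal n w" if k: "k < n" for k
  proof -
    have "det (H (Suc k)) = (\<Sum>j<n. H (Suc k) $$ (k, j) * cofactor (H (Suc k)) k j)"
      by (rule laplace_expansion_row[OF H k])
    also have "\<dots> = (\<Sum>j<n. D' $$ (k, j) * cofactor (H k) k j)"
    proof (rule sum.cong[OF refl])
      fix j assume j: "j \<in> {..<n}"
      have "cofactor (H (Suc k)) k j = cofactor (H k) k j"
        by (rule cofactor_cong_row[OF H H k]) (use j in \<open>auto simp: H_def\<close>)
      then show "H (Suc k) $$ (k, j) * cofactor (H (Suc k)) k j = D' $$ (k, j) * cofactor (H k) k j"
        using j k by (simp add: H_def)
    qed
    finally have "det (H k) - det (H (Suc k)) = (\<Sum>j<n. (D $$ (k, j) - D' $$ (k, j)) * cofactor (H k) k j)"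
      unfolding laplace_expansion_row[OF H k, of k]
      using k by (simp add: H_def left_diff_distrib sum_subtractf)
    also have "\<dots> \<in> fam_ideal n w"
    proof (rule syzygy_combination_in_fam_ideal[OF reg])
      show "(\<Sum>j<n. (D $$ (k, j) - D' $$ (k, j)) * v j) = 0"
        using w[OF k] w'[OF k] by (simp add: left_diff_distrib sum_subtractf)
      show "v b * cofactor (H k) k a - v a * cofactor (H k) k b \<in> fam_ideal n w"
        if "a < n" "b < n" for a b
      proof (rule cofactor_row_koszul[OF H k that])
        show "(\<Sum>j<n. H k $$ (i, j) * v j) = w i" if "i < n" for i
          using w[OF that] w'[OF that] that by (cases "i < k") (simp_all add: H_def)
      qed
    qed
    finally show ?thesis .
  qed
  have "det (H 0) - det (H k) \<in> fam_ideal n w" if "k \<le> n" for k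
    using that
  proof (induction k)
    case 0
    then show ?case by (simp add: fam_ideal_0)
  next
    case (Suc k)
    then show ?case using fam_ideal_add[OF Suc.IH step[of k]] by simp
  qed
  moreover have "H 0 = D" "H n = D'" using D D' by (auto simp: H_def)
  ultimately show ?thesis by (metis order_refl)
qed

section \<open>Comparison of \<open>det_on\<close> with the matrix determinant\<close>

lemma det_on_atMost: "det_on {0..m} A = det (mat (Suc m) (Suc m) (\<lambda>(i, j). A i j))"
proof -
  have "(\<Prod>i\<in>{0..m}. A i (p i)) = (\<Prod>i\<in>{0..<Suc m}. mat (Suc m) (Suc m) (\<lambda>(i, j). A i j) $$ (i, p i))"
    if "p permutes {0..m}" for p
  proof (rule prod.cong)
    fix i assume i: "i \<in> {0..<Suc m}"
    then have "p i < Suc m" using permutes_in_image[OF that, of i] by auto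
    then show "A i (p i) = mat (Suc m) (Suc m) (\<lambda>(i, j). A i j) $$ (i, p i)" using i by simp
  qed auto
  then show ?thesis unfolding det_on_def
    by (subst det_def'[of _ "Suc m"]) (auto simp: atLeastLessThanSuc_atLeastAtMost intro!: sum.cong)
qed

text \<open>Prepending a unit row at index 0 leads back to the range from 0: permutations that move
  0 contribute nothing, and Laplace expansion along that row deletes it again.\<close>

lemma det_on_from_1: "det_on {1..m} A = det (mat m m (\<lambda>(i, j). A (Suc i) (Suc j)))"
proof -
  define B where "B i j = (if i = 0 then if j = 0 then 1 else 0 else A i j)" for i j
  let ?M = "mat (Suc m) (Suc m) (\<lambda>(i, j). B i j)"
  have 01: "{0..m} = insert 0 {1..m}" by auto
  have "det_on {0..m} B = (\<Sum>p | p permutes {1..m}. of_int (sign p) * (\<Prod>i\<in>{0..m}. B i (p i)))"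
    unfolding det_on_def
  proof (rule sum.mono_neutral_right, goal_cases)
    case 1 then show ?case by (simp add: finite_permutations)
  next
    case 2 then show ?case by (auto intro: permutes_subset)
  next
    case 3
    show ?case
    proof
      fix p assume p: "p \<in> {p. p permutes {0..m}} - {p. p permutes {1..m}}"
      have "p 0 \<noteq> 0"
      proof
        assume "p 0 = 0"
        then have "p x = x" if "x \<in> {0..m} - {1..m}" for x
          using that by (cases "x = 0") auto
        then have "p permutes {1..m}"
          using p permutes_superset[of p "{0..m}" "{1..m}"] by blast
        then show False using p by simp
      qed
      then have "B 0 (p 0) = 0" by (simp add: B_def)
      then show "of_int (sign p) * (\<Prod>i\<in>{0..m}. B i (p i)) = 0"
        unfolding 01 by simp
    qed
  qed
  also have "\<dots> = det_on {1..m} A" unfolding det_on_def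
  proof (intro sum.cong refl arg_cong2[of _ _ _ _ "(*)"])
    fix p assume "p \<in> {p. p permutes {1..m}}"
    then have "p 0 = 0" by (auto simp: permutes_def)
    then show "(\<Prod>i\<in>{0..m}. B i (p i)) = (\<Prod>i\<in>{1..m}. A i (p i))"
      unfolding 01 by (simp add: B_def)
  qed
  finally have "det_on {1..m} A = det ?M" by (simp add: det_on_atMost)
  also have "\<dots> = (\<Sum>j<Suc m. ?M $$ (0, j) * cofactor ?M 0 j)"
    by (rule laplace_expansion_row[of _ "Suc m"]) auto
  also have "\<dots> = cofactor ?M 0 0"
    by (subst sum.lessThan_Suc_shift) (simp add: B_def)
  also have "\<dots> = det (mat_delete ?M 0 0)" by (simp add: cofactor_def)
  also have "mat_delete ?M 0 0 = mat m m (\<lambda>(i, j). A (Suc i) (Suc j))"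
    by (rule eq_matI) (auto simp: mat_delete_def B_def)
  finally show ?thesis .
qed

subsection \<open>Functionals acting on the second group of variables\<close>

definition xpart :: "nat \<Rightarrow> (nat \<Rightarrow>\<^sub>0 nat) \<Rightarrow> (nat \<Rightarrow>\<^sub>0 nat)" where
  "xpart m \<gamma> = (\<Sum>k<m. Poly_Mapping.single k (Poly_Mapping.lookup \<gamma> k))"

definition ypart :: "nat \<Rightarrow> (nat \<Rightarrow>\<^sub>0 nat) \<Rightarrow> (nat \<Rightarrow>\<^sub>0 nat)" where
  "ypart m \<gamma> = (\<Sum>k<m. Poly_Mapping.single k (Poly_Mapping.lookup \<gamma> (m + k)))"

definition to_y :: "nat \<Rightarrow> 'a::comm_ring_1 mpoly \<Rightarrow> 'a mpoly" where
  "to_y m = msubst (\<lambda>k. mvar (m + k))"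

definition diag :: "nat \<Rightarrow> 'a::comm_ring_1 mpoly \<Rightarrow> 'a mpoly" where
  "diag m = msubst (\<lambda>k. if k < m then mvar k else mvar (k - m))"

text \<open>The functional \<open>t\<close> on polynomials in y, extended K[x]-linearly to
  K[x,y].\<close>

definition yapply :: "nat \<Rightarrow> ((nat \<Rightarrow>\<^sub>0 nat) \<Rightarrow> 'a::comm_ring_1) \<Rightarrow> 'a mpoly \<Rightarrow> 'a mpoly" where
  "yapply m t = lin_ext (\<lambda>\<gamma>. mconst (t (ypart m \<gamma>)) * mmonom (xpart m \<gamma>))"

lemma lookup_xpart:
  "Poly_Mapping.lookup (xpart m \<gamma>) j = (if j < m then Poly_Mapping.lookup \<gamma> j else 0)"
  by (simp add: xpart_def lookup_sum lookup_single when_def)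

lemma lookup_ypart:
  "Poly_Mapping.lookup (ypart m \<gamma>) j = (if j < m then Poly_Mapping.lookup \<gamma> (m + j) else 0)"
  by (simp add: ypart_def lookup_sum lookup_single when_def)

lemma lookup_yshift:
  "Poly_Mapping.lookup (yshift m \<beta>) j = (if m \<le> j then Poly_Mapping.lookup \<beta> (j - m) else 0)"
proof -
  have "Poly_Mapping.lookup (yshift m \<beta>) j =
      (\<Sum>k\<in>Poly_Mapping.keys \<beta>. if m \<le> j \<and> k = j - m then Poly_Mapping.lookup \<beta> k else 0)"
    unfolding yshift_def lookup_sum by (rule sum.cong) (auto simp: lookup_single when_def)
  also have "\<dots> = (if m \<le> j then Poly_Mapping.lookup \<beta> (j - m) else 0)"
    by (cases "m \<le> j") (simp_all add: in_keys_iff)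
  finally show ?thesis .
qed

lemma keys_subset_lessThan:
  fixes \<alpha> :: "nat \<Rightarrow>\<^sub>0 nat"
  shows "Poly_Mapping.keys \<alpha> \<subseteq> {..<m} \<longleftrightarrow> (\<forall>j\<ge>m. Poly_Mapping.lookup \<alpha> j = 0)"
  by (auto simp: in_keys_iff subset_iff) (metis leI less_irrefl)

lemma xpart_add: "xpart m (\<alpha> + \<beta>) = xpart m \<alpha> + xpart m \<beta>"
  by (rule poly_mapping_eqI) (simp add: lookup_xpart lookup_add)

lemma ypart_add: "ypart m (\<alpha> + \<beta>) = ypart m \<alpha> + ypart m \<beta>"
  by (rule poly_mapping_eqI) (simp add: lookup_ypart lookup_add)

lemma xpart_of_x: "Poly_Mapping.keys \<alpha> \<subseteq> {..<m} \<Longrightarrow> xpart m \<alpha> = \<alpha>"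
  by (rule poly_mapping_eqI) (simp add: lookup_xpart keys_subset_lessThan)

lemma ypart_of_x: "Poly_Mapping.keys \<alpha> \<subseteq> {..<m} \<Longrightarrow> ypart m \<alpha> = 0"
  by (rule poly_mapping_eqI) (simp add: lookup_ypart keys_subset_lessThan)

lemma xpart_yshift: "xpart m (yshift m \<beta>) = 0"
  by (rule poly_mapping_eqI) (simp add: lookup_xpart lookup_yshift)

lemma ypart_yshift: "Poly_Mapping.keys \<beta> \<subseteq> {..<m} \<Longrightarrow> ypart m (yshift m \<beta>) = \<beta>"
  by (rule poly_mapping_eqI) (simp add: lookup_ypart lookup_yshift keys_subset_lessThan)

lemma keys_xpart: "Poly_Mapping.keys (xpart m \<gamma>) \<subseteq> {..<m}"
  by (simp add: keys_subset_lessThan lookup_xpart)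

lemma keys_ypart: "Poly_Mapping.keys (ypart m \<gamma>) \<subseteq> {..<m}"
  by (simp add: keys_subset_lessThan lookup_ypart)

lemma xpart_plus_yshift_ypart:
  "Poly_Mapping.keys \<gamma> \<subseteq> {..<2 * m} \<Longrightarrow> xpart m \<gamma> + yshift m (ypart m \<gamma>) = \<gamma>"
  by (rule poly_mapping_eqI)
     (auto simp: lookup_add lookup_xpart lookup_ypart lookup_yshift keys_subset_lessThan not_less)

lemma yapply_0 [simp]: "yapply m t 0 = 0"
  by (simp add: yapply_def)

lemma yapply_add: "yapply m t (F + G) = yapply m t F + yapply m t G"
  by (simp add: yapply_def lin_ext_add)

lemma yapply_diff: "yapply m t (F - G) = yapply m t F - yapply m t G"
  by (simp add: yapply_def lin_ext_diff)

lemma yapply_sum: "yapply m t (sum f S) = (\<Sum>i\<in>S. yapply m t (f i))"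
  by (simp add: yapply_def lin_ext_sum)

lemma yapply_monom:
  "yapply m t (mconst c * mmonom \<gamma>) = mconst c * (mconst (t (ypart m \<gamma>)) * mmonom (xpart m \<gamma>))"
  by (simp add: yapply_def lin_ext_mconst_mult lin_ext_monom)

lemma yapply_in: "yapply m t F \<in> polys_in m"
  unfolding yapply_def lin_ext_def by (intro polys_in_intros keys_xpart)

lemma yapply_x_mult:
  assumes "p \<in> polys_in m"
  shows "yapply m t (p * F) = p * yapply m t F"
proof (induction p rule: mpoly_monom_induct)
  case (monom \<alpha> c)
  then have \<alpha>: "Poly_Mapping.keys \<alpha> \<subseteq> {..<m}" using assms by (auto simp: polys_in_def)
  show ?case
  proof (induction F rule: mpoly_monom_induct)
    case (monom \<gamma> d)
    have "mconst c * mmonom \<alpha> * (mconst d * mmonom \<gamma>) = mconst (c * d) * mmonom (\<alpha> + \<gamma>)"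
      by (simp add: mmonom_add mconst_mult mult_ac)
    then have "yapply m t (mconst c * mmonom \<alpha> * (mconst d * mmonom \<gamma>)) =
        mconst (c * d) * (mconst (t (ypart m \<gamma>)) * mmonom (\<alpha> + xpart m \<gamma>))"
      by (simp only: yapply_monom xpart_add ypart_add xpart_of_x[OF \<alpha>] ypart_of_x[OF \<alpha>] add_0)
    then show ?case by (simp add: yapply_monom mmonom_add mconst_mult mult_ac)
  qed (auto simp: yapply_add algebra_simps)
qed (auto simp: yapply_add algebra_simps)

lemma to_y_mmonom: "to_y m (mmonom \<alpha>) = mmonom (yshift m \<alpha>)"
  by (simp add: to_y_def msubst_mmonom yshift_def mmonom_sum mvar_power)

text \<open>Multiplication by q(y) before applying \<open>t\<close> is the action of
  \<open>q\<close> on the dual space: \<open>t\<close> is replaced by the functional that multiplies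
  by \<open>q\<close> first.\<close>

lemma yapply_y_mult:
  assumes "q \<in> polys_in m"
  shows "yapply m t (to_y m q * F) = yapply m (\<lambda>\<beta>. functional t (q * mmonom \<beta>)) F"
proof (induction F rule: mpoly_monom_induct)
  case (monom \<gamma> d)
  show ?case
  proof (induction q rule: mpoly_monom_induct)
    case (monom \<alpha> c)
    then have \<alpha>: "Poly_Mapping.keys \<alpha> \<subseteq> {..<m}" using assms by (auto simp: polys_in_def)
    have "to_y m (mconst c * mmonom \<alpha>) = mconst c * mmonom (yshift m \<alpha>)"
      using to_y_mmonom[of m \<alpha>, where 'a = 'a] by (simp add: to_y_def msubst_mconst_mult)
    then have "to_y m (mconst c * mmonom \<alpha>) * (mconst d * mmonom \<gamma>) = mconst (c * d) * mmonom (yshift m \<alpha> + \<gamma>)"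
      by (simp add: mmonom_add mconst_mult mult_ac)
    moreover have "functional t (mconst c * mmonom \<alpha> * mmonom \<beta>) = c * t (\<alpha> + \<beta>)" for \<beta>
      by (simp add: mult.assoc functional_mconst_mult functional_monom flip: mmonom_add)
    ultimately show ?case
      by (simp only: yapply_monom xpart_add ypart_add xpart_yshift ypart_yshift[OF \<alpha>] add_0)
         (simp add: mconst_mult mult_ac)
  qed (auto simp: yapply_monom to_y_def msubst_add distrib_right functional_add mconst_add
      yapply_add distrib_left)
qed (auto simp: yapply_add algebra_simps)

lemma yapply_eq_0:
  assumes "\<And>\<beta>. Poly_Mapping.keys \<beta> \<subseteq> {..<m} \<Longrightarrow> t \<beta> = 0"
  shows "yapply m t F = 0"
  unfolding yapply_def lin_ext_def using assms keys_ypart by simp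

text \<open>This turns the double sums of the theorem into \<open>yapply\<close>. An exponent of
  \<open>B\<close> splits uniquely into an x part and a shifted y part, and \<open>E\<close> and
  \<open>E'\<close> contain all the parts that occur.\<close>

lemma yapply_coeff_sum:
  assumes B: "B \<in> polys_in (2 * m)" and fin: "finite E" "finite E'"
    and E: "\<forall>\<alpha>\<in>E. Poly_Mapping.keys \<alpha> \<subseteq> {..<m}" and E': "\<forall>\<beta>\<in>E'. Poly_Mapping.keys \<beta> \<subseteq> {..<m}"
    and supp: "\<And>\<alpha> \<beta>. Poly_Mapping.keys \<alpha> \<subseteq> {..<m} \<Longrightarrow> Poly_Mapping.keys \<beta> \<subseteq> {..<m} \<Longrightarrow>
      Poly_Mapping.lookup B (\<alpha> + yshift m \<beta>) \<noteq> 0 \<Longrightarrow> \<alpha> \<in> E \<and> \<beta> \<in> E'"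
  shows "(\<Sum>\<alpha>\<in>E. \<Sum>\<beta>\<in>E'. mconst (Poly_Mapping.lookup B (\<alpha> + yshift m \<beta>) * lam \<beta>) * mmonom \<alpha>) =
    yapply m lam B"
proof -
  let ?h = "\<lambda>(\<alpha>, \<beta>). \<alpha> + yshift m \<beta>"
  have xp: "xpart m (\<alpha> + yshift m \<beta>) = \<alpha>" and yp: "ypart m (\<alpha> + yshift m \<beta>) = \<beta>"
    if "\<alpha> \<in> E" "\<beta> \<in> E'" for \<alpha> \<beta>
    using that E E' by (simp_all add: xpart_add ypart_add xpart_yshift ypart_yshift xpart_of_x ypart_of_x)
  have inj: "inj_on ?h (E \<times> E')"
  proof (rule inj_onI, clarify)
    fix a b c d assume "a \<in> E" "b \<in> E'" "c \<in> E" "d \<in> E'" "a + yshift m b = c + yshift m d"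
    then show "a = c \<and> b = d" using xp yp by metis
  qed
  have sub: "Poly_Mapping.keys B \<subseteq> ?h ` (E \<times> E')"
  proof
    fix \<gamma> assume \<gamma>: "\<gamma> \<in> Poly_Mapping.keys B"
    then have "Poly_Mapping.keys \<gamma> \<subseteq> {..<2 * m}" using B by (auto simp: polys_in_def)
    then have eq: "\<gamma> = xpart m \<gamma> + yshift m (ypart m \<gamma>)" by (simp add: xpart_plus_yshift_ypart)
    then have "xpart m \<gamma> \<in> E \<and> ypart m \<gamma> \<in> E'"
      using \<gamma> by (intro supp keys_xpart keys_ypart) (simp add: in_keys_iff)
    then show "\<gamma> \<in> ?h ` (E \<times> E')"
      using eq by (intro image_eqI[of _ _ "(xpart m \<gamma>, ypart m \<gamma>)"]) auto
  qed
  have "yapply m lam B = (\<Sum>\<gamma>\<in>?h ` (E \<times> E'). mconst (Poly_Mapping.lookup B \<gamma>) *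
      (mconst (lam (ypart m \<gamma>)) * mmonom (xpart m \<gamma>)))"
    unfolding yapply_def by (rule lin_ext_superset) (use fin sub in auto)
  also have "\<dots> = (\<Sum>(\<alpha>, \<beta>)\<in>E \<times> E'. mconst (Poly_Mapping.lookup B (\<alpha> + yshift m \<beta>)) *
      (mconst (lam \<beta>) * mmonom \<alpha>))"
    unfolding sum.reindex[OF inj] by (rule sum.cong) (auto simp: xp yp)
  also have "\<dots> = (\<Sum>\<alpha>\<in>E. \<Sum>\<beta>\<in>E'. mconst (Poly_Mapping.lookup B (\<alpha> + yshift m \<beta>) * lam \<beta>) * mmonom \<alpha>)"
    by (simp add: sum.cartesian_product mconst_mult mult.assoc)
  finally show ?thesis by simp
qed

subsection \<open>Divided differences\<close>

definition xy :: "nat \<Rightarrow> nat \<Rightarrow> 'a::comm_ring_1 mpoly" where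
  "xy m l = mvar l - mvar (m + l)"

lemma mvar_eq_iff: "(mvar k :: 'a::{comm_ring_1, zero_neq_one} mpoly) = mvar l \<longleftrightarrow> k = l"
proof
  assume "mvar k = (mvar l :: 'a mpoly)"
  then have "Poly_Mapping.lookup (mvar k :: 'a mpoly) (Poly_Mapping.single k 1) =
    Poly_Mapping.lookup (mvar l) (Poly_Mapping.single k 1)" by simp
  then have "Poly_Mapping.single l (1::nat) = Poly_Mapping.single k 1"
    by (auto simp: mvar_def lookup_single when_def split: if_splits)
  then have "Poly_Mapping.keys (Poly_Mapping.single l (1::nat)) = Poly_Mapping.keys (Poly_Mapping.single k (1::nat))" by simp
  then show "k = l" by simp
qed auto

lemma xy_neq_0: "l < m \<Longrightarrow> xy m l \<noteq> (0 :: 'a::idom mpoly)"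
  by (simp add: xy_def mvar_eq_iff)

lemma diag_Xsubst: "p \<in> polys_in m \<Longrightarrow> diag m (msubst (Xsubst m i) p) = p"
proof -
  assume p: "p \<in> polys_in m"
  have "diag m (msubst (Xsubst m i) p) = msubst mvar p"
    unfolding diag_def msubst_msubst by (rule msubst_cong[OF p]) (simp add: Xsubst_def)
  then show ?thesis by (simp add: msubst_mvar_id)
qed

text \<open>The quotient is built along the ring structure of \<open>p\<close>. Products use the
  twisted Leibniz rule p1 p2 - p1' p2' = (p1 - p1') p2 + p1' (p2 - p2'), where unprimed factors are
  taken at \<open>Xsubst m l\<close> and primed ones at \<open>Xsubst m (Suc l)\<close>. On the
  diagonal y = x it becomes the ordinary Leibniz rule, which yields the partial derivative.\<close>

lemma divdiff_exists:
  assumes "p \<in> polys_in m" "l < m"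
  shows "\<exists>q\<in>polys_in (2 * m). q * xy m l = msubst (Xsubst m l) p - msubst (Xsubst m (Suc l)) p \<and>
    diag m q = mpderiv l p"
  using assms(1)
proof (induction rule: polys_in_induct)
  case (const c)
  then show ?case by (intro bexI[of _ 0]) (auto simp: diag_def)
next
  case (var k)
  show ?case
  proof (cases "k = l")
    case True
    then show ?thesis
      by (intro bexI[of _ 1]) (auto simp: diag_def mpderiv_mvar Xsubst_def xy_def)
  next
    case False
    then show ?thesis
      by (intro bexI[of _ 0]) (auto simp: diag_def mpderiv_mvar Xsubst_def)
  qed
next
  case (add p1 p2)
  then obtain q1 q2 where q: "q1 \<in> polys_in (2 * m)" "q2 \<in> polys_in (2 * m)"
    "q1 * xy m l = msubst (Xsubst m l) p1 - msubst (Xsubst m (Suc l)) p1" "diag m q1 = mpderiv l p1"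
    "q2 * xy m l = msubst (Xsubst m l) p2 - msubst (Xsubst m (Suc l)) p2" "diag m q2 = mpderiv l p2"
    by auto
  show ?case
    using q by (intro bexI[of _ "q1 + q2"])
      (auto simp: distrib_right msubst_add mpderiv_add polys_in_add diag_def)
next
  case (mult p1 p2)
  then obtain q1 q2 where q: "q1 \<in> polys_in (2 * m)" "q2 \<in> polys_in (2 * m)"
    "q1 * xy m l = msubst (Xsubst m l) p1 - msubst (Xsubst m (Suc l)) p1" "diag m q1 = mpderiv l p1"
    "q2 * xy m l = msubst (Xsubst m l) p2 - msubst (Xsubst m (Suc l)) p2" "diag m q2 = mpderiv l p2"
    by auto
  let ?q = "q1 * msubst (Xsubst m l) p2 + msubst (Xsubst m (Suc l)) p1 * q2"
  have "?q * xy m l = (q1 * xy m l) * msubst (Xsubst m l) p2 + msubst (Xsubst m (Suc l)) p1 * (q2 * xy m l)"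
    by (simp add: algebra_simps)
  also have "\<dots> = msubst (Xsubst m l) (p1 * p2) - msubst (Xsubst m (Suc l)) (p1 * p2)"
    unfolding q by (simp add: msubst_mult algebra_simps)
  finally have 1: "?q * xy m l = msubst (Xsubst m l) (p1 * p2) - msubst (Xsubst m (Suc l)) (p1 * p2)" .
  have "diag m ?q = diag m q1 * diag m (msubst (Xsubst m l) p2) + diag m (msubst (Xsubst m (Suc l)) p1) * diag m q2"
    by (simp add: diag_def msubst_add msubst_mult)
  also have "\<dots> = mpderiv l (p1 * p2)" by (simp add: q diag_Xsubst mult.hyps mpderiv_mult)
  finally have 2: "diag m ?q = mpderiv l (p1 * p2)" .
  have "?q \<in> polys_in (2 * m)"
    using q mult.hyps
    by (intro polys_in_add polys_in_mult msubst_polys_in[of _ m]) (auto simp: Xsubst_def polys_in_mvar)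
  then show ?case using 1 2 by blast
qed

text \<open>Polynomials over a domain form a domain, so cancelling \<open>xy m l\<close> shows the
  quotient in the definite description to be unique.\<close>

lemma divdiff_unique:
  fixes p :: "'a::idom mpoly"
  assumes "l < m" "q * xy m l = msubst (Xsubst m l) p - msubst (Xsubst m (Suc l)) p"
  shows "divdiff m (Suc l) p = q"
  unfolding divdiff_def
proof (rule the_equality)
  show "q * (mvar (Suc l - 1) - mvar (m + Suc l - 1)) =
    msubst (Xsubst m (Suc l - 1)) p - msubst (Xsubst m (Suc l)) p"
    using assms(2) by (simp add: xy_def)
  fix q' assume "q' * (mvar (Suc l - 1) - mvar (m + Suc l - 1)) =
    msubst (Xsubst m (Suc l - 1)) p - msubst (Xsubst m (Suc l)) p"
  then have "q' * xy m l = q * xy m l" using assms(2) by (simp add: xy_def)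
  then show "q' = q" using xy_neq_0[OF assms(1), where 'a = 'a] by simp
qed

lemma divdiff:
  fixes p :: "'a::idom mpoly"
  assumes "p \<in> polys_in m" "l < m"
  shows divdiff_in: "divdiff m (Suc l) p \<in> polys_in (2 * m)"
    and divdiff_mult: "divdiff m (Suc l) p * xy m l = msubst (Xsubst m l) p - msubst (Xsubst m (Suc l)) p"
    and diag_divdiff: "diag m (divdiff m (Suc l) p) = mpderiv l p"
proof -
  obtain q where "q \<in> polys_in (2 * m)"
    "q * xy m l = msubst (Xsubst m l) p - msubst (Xsubst m (Suc l)) p" "diag m q = mpderiv l p"
    using divdiff_exists[OF assms] by blast
  moreover from this have "divdiff m (Suc l) p = q" using assms by (intro divdiff_unique)
  ultimately show "divdiff m (Suc l) p \<in> polys_in (2 * m)"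
    "divdiff m (Suc l) p * xy m l = msubst (Xsubst m l) p - msubst (Xsubst m (Suc l)) p"
    "diag m (divdiff m (Suc l) p) = mpderiv l p" by auto
qed

lemma divdiff_1: "l < m \<Longrightarrow> divdiff m (Suc l) (1 :: 'a::idom mpoly) = 0"
  by (rule divdiff_unique) auto

text \<open>The sum telescopes along the points \<open>Xsubst m 0\<close>, ...,
  \<open>Xsubst m m\<close>, from x to y.\<close>

lemma sum_divdiff:
  fixes p :: "'a::idom mpoly"
  assumes "p \<in> polys_in m"
  shows "(\<Sum>l<m. divdiff m (Suc l) p * xy m l) = p - to_y m p"
proof -
  have "(\<Sum>l<m. divdiff m (Suc l) p * xy m l) =
      (\<Sum>l<m. msubst (Xsubst m l) p - msubst (Xsubst m (Suc l)) p)"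
    by (rule sum.cong) (use divdiff_mult[OF assms] in auto)
  also have "\<dots> = msubst (Xsubst m 0) p - msubst (Xsubst m m) p"
    by (rule sum_lessThan_telescope')
  also have "msubst (Xsubst m 0) p = msubst mvar p"
    by (rule msubst_cong[OF assms]) (simp add: Xsubst_def)
  also have "msubst (Xsubst m m) p = to_y m p"
    unfolding to_y_def by (rule msubst_cong[OF assms]) (simp add: Xsubst_def)
  finally show ?thesis by (simp add: msubst_mvar_id)
qed

text \<open>Setting y equal to x in the first \<open>k\<close> coordinates is a retraction
  \<open>\<theta>\<close> that kills the first \<open>k\<close> differences and preserves classes
  modulo them. It fixes \<open>xy m k\<close>, so \<open>\<theta> r\<close> is 0 by
  cancellation.\<close>

lemma regular_seq_xy: "regular_seq m (xy m :: nat \<Rightarrow> 'a::idom mpoly)"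
  unfolding regular_seq_def
proof (intro allI impI)
  fix k and r :: "'a mpoly"
  assume k: "k < m" and r: "r * xy m k \<in> fam_ideal k (xy m)"
  define \<theta> :: "'a mpoly \<Rightarrow> 'a mpoly" where
    "\<theta> = msubst (\<lambda>i. if m \<le> i \<and> i < m + k then mvar (i - m) else mvar i)"
  have diff: "p - \<theta> p \<in> fam_ideal k (xy m)" for p
  proof -
    obtain n where "p \<in> polys_in n" using polys_in_UN by blast
    then show ?thesis
    proof (induction rule: polys_in_induct)
      case (const c)
      then show ?case by (simp add: \<theta>_def fam_ideal_0)
    next
      case (var i)
      show ?case
      proof (cases "m \<le> i \<and> i < m + k")
        case True
        then have "mvar i - \<theta> (mvar i) = - xy m (i - m)" by (simp add: \<theta>_def xy_def)
        also have "\<dots> \<in> fam_ideal k (xy m)" using True by (intro fam_ideal_uminus fam_ideal_mem) auto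
        finally show ?thesis .
      next
        case False
        then have "\<theta> (mvar i) = mvar i" unfolding \<theta>_def by (simp only: msubst_mvar if_False)
        then show ?thesis by (simp add: fam_ideal_0)
      qed
    next
      case (add p q)
      have "p + q - \<theta> (p + q) = (p - \<theta> p) + (q - \<theta> q)" by (simp add: \<theta>_def msubst_add)
      then show ?case using add by (simp only: fam_ideal_add)
    next
      case (mult p q)
      have "p * q - \<theta> (p * q) = p * (q - \<theta> q) + \<theta> q * (p - \<theta> p)"
        by (simp add: \<theta>_def msubst_mult algebra_simps)
      then show ?case using mult by (simp only: fam_ideal_add fam_ideal_mult)
    qed
  qed
  obtain c where "r * xy m k = (\<Sum>a<k. c a * xy m a)" using r by (auto simp: fam_ideal_def)
  then have "\<theta> (r * xy m k) = (\<Sum>a<k. \<theta> (c a) * \<theta> (xy m a))"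
    by (simp add: \<theta>_def msubst_sum msubst_mult)
  moreover have "\<theta> (xy m a) = 0" if "a < k" for a
    using that k by (simp add: \<theta>_def xy_def msubst_diff)
  moreover have "\<theta> (r * xy m k) = \<theta> r * xy m k"
    using k by (simp add: \<theta>_def xy_def msubst_diff msubst_mult)
  ultimately have "\<theta> r * xy m k = 0" by simp
  then have "\<theta> r = 0" using xy_neq_0[OF k, where 'a = 'a] by simp
  then show "r \<in> fam_ideal k (xy m)" using diff[of r] by simp
qed

subsection \<open>The Bezoutian\<close>

text \<open>The Bezoutian of 1 (see \<open>bezoutian_1\<close>): a discrete Jacobian, whose
  restriction to the diagonal y = x is the Jacobian.\<close>

definition bez_delta :: "nat \<Rightarrow> (nat \<Rightarrow> 'a::comm_ring_1 mpoly) \<Rightarrow> 'a mpoly" where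
  "bez_delta m fs = det (mat m m (\<lambda>(i, j). divdiff m (Suc j) (fs (Suc i))))"

lemma polys_in_det_on:
  assumes "\<And>i j. i \<in> S \<Longrightarrow> j \<in> S \<Longrightarrow> A i j \<in> polys_in n"
  shows "det_on S A \<in> polys_in n"
  unfolding det_on_def using assms permutes_in_image
  by (intro polys_in_sum polys_in_mult polys_in_of_int polys_in_prod) fastforce

lemma polys_in_det:
  assumes "\<And>i j. i < m \<Longrightarrow> j < m \<Longrightarrow> A $$ (i, j) \<in> polys_in n" "A \<in> carrier_mat m m"
  shows "det A \<in> polys_in n"
proof -
  have "A = mat m m (\<lambda>(i, j). A $$ (Suc i - 1, Suc j - 1))" using assms(2) by (intro eq_matI) auto
  then have "det A = det_on {1..m} (\<lambda>i j. A $$ (i - 1, j - 1))"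
    unfolding det_on_from_1 by simp
  also have "\<dots> \<in> polys_in n" using assms(1) by (intro polys_in_det_on) auto
  finally show ?thesis .
qed

context
  fixes m :: nat and fs :: "nat \<Rightarrow> 'a::idom mpoly"
  assumes fs_in: "\<And>i. i < m \<Longrightarrow> fs (Suc i) \<in> polys_in m"
begin

lemma bez_delta_in: "bez_delta m fs \<in> polys_in (2 * m)"
  unfolding bez_delta_def by (rule polys_in_det[of m]) (auto intro: divdiff_in fs_in)

lemma jacobian_in: "jacobian m fs \<in> polys_in m"
proof -
  have "fs i \<in> polys_in m" if "i \<in> {1..m}" for i using fs_in[of "i - 1"] that by (cases i) auto
  then show ?thesis unfolding jacobian_def by (intro polys_in_det_on polys_in_mpderiv)
qed

text \<open>Setting y = x is a ring homomorphism, so it commutes with the determinant and acts on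
  the divided differences entrywise.\<close>

lemma diag_bez_delta: "diag m (bez_delta m fs) = jacobian m fs"
proof -
  interpret comm_ring_hom "diag m :: 'a mpoly \<Rightarrow> 'a mpoly"
    unfolding diag_def by (rule comm_ring_hom_msubst)
  have "map_mat (diag m) (mat m m (\<lambda>(i, j). divdiff m (Suc j) (fs (Suc i)))) =
      mat m m (\<lambda>(i, j). mpderiv j (fs (Suc i)))"
    by (rule eq_matI) (auto simp: diag_divdiff fs_in)
  then have "diag m (bez_delta m fs) = det (mat m m (\<lambda>(i, j). mpderiv j (fs (Suc i))))"
    unfolding bez_delta_def by (metis hom_det)
  then show ?thesis unfolding jacobian_def det_on_from_1 by simp
qed

lemma bezoutian_in:
  assumes "f0 \<in> polys_in m"
  shows "bezoutian m fs f0 \<in> polys_in (2 * m)"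
  unfolding bezoutian_def
proof (rule polys_in_det_on)
  fix i j assume "i \<in> {0..m}" "j \<in> {0..m}"
  then have "(if i = 0 then f0 else fs i) \<in> polys_in m" using assms fs_in[of "i - 1"] by auto
  then show "(let fi = if i = 0 then f0 else fs i in if j = 0 then fi else divdiff m j fi) \<in> polys_in (2 * m)"
    using \<open>j \<in> {0..m}\<close> divdiff_in[of _ m "j - 1"] polys_in_mono[of m "2 * m"]
    by (cases j) (auto simp: Let_def)
qed

text \<open>The first form is Laplace expansion along column 0. By \<open>sum_divdiff\<close> the
  column of differences f_i(x) - f_i(y) is a combination of the other columns, so column 0 may be
  evaluated at y without changing its cofactors or the value; hence the same \<open>c\<close> in
  both forms.\<close>

lemma bezoutian_expand:
  assumes f0: "f0 \<in> polys_in m"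
  obtains c where
    "bezoutian m fs f0 = f0 * bez_delta m fs + (\<Sum>i<m. fs (Suc i) * c i)"
    "bezoutian m fs f0 = to_y m f0 * bez_delta m fs + (\<Sum>i<m. to_y m (fs (Suc i)) * c i)"
proof -
  define F where "F i = (if i = 0 then f0 else fs i)" for i
  have F: "F i \<in> polys_in m" if "i < Suc m" for i
    using that f0 fs_in[of "i - 1"] by (auto simp: F_def)
  define N where "N = mat (Suc m) (Suc m) (\<lambda>(i, j). if j = 0 then F i else divdiff m j (F i))"
  have N: "N \<in> carrier_mat (Suc m) (Suc m)" by (simp add: N_def)
  have bez: "bezoutian m fs f0 = det N"
    unfolding bezoutian_def det_on_atMost N_def F_def Let_def by simp
  have "mat_delete N 0 0 = mat m m (\<lambda>(i, j). divdiff m (Suc j) (fs (Suc i)))"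
    by (rule eq_matI) (auto simp: mat_delete_def N_def F_def)
  then have c0: "cofactor N 0 0 = bez_delta m fs" by (simp add: cofactor_def bez_delta_def)
  have "det N = (\<Sum>i<Suc m. N $$ (i, 0) * cofactor N i 0)"
    by (rule laplace_expansion_column[OF N]) simp
  also have "\<dots> = (\<Sum>i<Suc m. F i * cofactor N i 0)" by (rule sum.cong) (auto simp: N_def)
  finally have 1: "det N = (\<Sum>i<Suc m. F i * cofactor N i 0)" .
  have "(\<Sum>i<Suc m. (F i - to_y m (F i)) * cofactor N i 0) =
      (\<Sum>i<Suc m. \<Sum>l<m. xy m l * (cofactor N i 0 * N $$ (i, Suc l)))"
  proof (rule sum.cong[OF refl])
    fix i assume i: "i \<in> {..<Suc m}"
    then have "F i - to_y m (F i) = (\<Sum>l<m. N $$ (i, Suc l) * xy m l)"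
      using sum_divdiff[OF F, of i] by (simp add: N_def)
    then show "(F i - to_y m (F i)) * cofactor N i 0 = (\<Sum>l<m. xy m l * (cofactor N i 0 * N $$ (i, Suc l)))"
      by (simp add: sum_distrib_left sum_distrib_right mult_ac)
  qed
  also have "\<dots> = (\<Sum>l<m. xy m l * (\<Sum>i<Suc m. cofactor N i 0 * N $$ (i, Suc l)))"
    by (subst sum.swap) (simp only: sum_distrib_left)
  also have "\<dots> = 0"
  proof (rule sum.neutral, rule ballI)
    fix l assume "l \<in> {..<m}"
    then have "(\<Sum>i<Suc m. cofactor N i 0 * N $$ (i, Suc l)) = 0"
      using sum_cofactor_mult[OF N, of 0 "Suc l"] by simp
    then show "xy m l * (\<Sum>i<Suc m. cofactor N i 0 * N $$ (i, Suc l)) = 0" by simp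
  qed
  finally have "(\<Sum>i<Suc m. F i * cofactor N i 0) = (\<Sum>i<Suc m. to_y m (F i) * cofactor N i 0)"
    by (simp add: left_diff_distrib sum_subtractf)
  then have 2: "det N = (\<Sum>i<Suc m. to_y m (F i) * cofactor N i 0)" using 1 by simp
  show ?thesis
  proof (rule that[of "\<lambda>i. cofactor N (Suc i) 0"])
    show "bezoutian m fs f0 = f0 * bez_delta m fs + (\<Sum>i<m. fs (Suc i) * cofactor N (Suc i) 0)"
      unfolding bez 1 sum.lessThan_Suc_shift by (simp add: F_def c0)
    show "bezoutian m fs f0 = to_y m f0 * bez_delta m fs + (\<Sum>i<m. to_y m (fs (Suc i)) * cofactor N (Suc i) 0)"
      unfolding bez 2 sum.lessThan_Suc_shift by (simp add: F_def c0)
  qed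
qed

text \<open>The divided differences of 1 vanish, so row 0 is a unit vector.\<close>

lemma bezoutian_1: "bezoutian m fs 1 = bez_delta m fs"
proof -
  let ?N = "mat (Suc m) (Suc m) (\<lambda>(i, j). let fi = if i = 0 then 1 else fs i in
      if j = 0 then fi else divdiff m j fi)"
  have "bezoutian m fs 1 = det ?N" unfolding bezoutian_def det_on_atMost ..
  also have "\<dots> = (\<Sum>j<Suc m. ?N $$ (0, j) * cofactor ?N 0 j)"
    by (rule laplace_expansion_row[of _ "Suc m"]) auto
  also have "\<dots> = cofactor ?N 0 0"
    by (subst sum.lessThan_Suc_shift) (simp add: divdiff_1)
  also have "\<dots> = det (mat_delete ?N 0 0)" by (simp add: cofactor_def)
  also have "mat_delete ?N 0 0 = mat m m (\<lambda>(i, j). divdiff m (Suc j) (fs (Suc i)))"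
    by (rule eq_matI) (auto simp: mat_delete_def)
  finally show ?thesis by (simp add: bez_delta_def)
qed

end

subsection \<open>The residue functional\<close>

context
  fixes m :: nat and fs :: "nat \<Rightarrow> 'a::comm_ring_1 mpoly"
begin

text \<open>The generators carry indices from 1 to \<open>m\<close>; the shift to k < m matches
  matrix indices.\<close>

lemma gen_ideal_iff:
  "p \<in> gen_ideal m fs \<longleftrightarrow> (\<exists>g. (\<forall>k<m. g k \<in> polys_in m) \<and> p = (\<Sum>k<m. g k * fs (Suc k)))"
proof
  assume "p \<in> gen_ideal m fs"
  then obtain g where "p = (\<Sum>i=1..m. g i * fs i)" "\<forall>i\<in>{1..m}. g i \<in> polys_in m"
    by (auto simp: gen_ideal_def)
  then show "\<exists>g. (\<forall>k<m. g k \<in> polys_in m) \<and> p = (\<Sum>k<m. g k * fs (Suc k))"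
    by (intro exI[of _ "\<lambda>k. g (Suc k)"]) (auto simp: sum.atLeast1_atMost_eq)
next
  assume "\<exists>g. (\<forall>k<m. g k \<in> polys_in m) \<and> p = (\<Sum>k<m. g k * fs (Suc k))"
  then obtain g where "\<forall>k<m. g k \<in> polys_in m" "p = (\<Sum>k<m. g k * fs (Suc k))" by blast
  then have "p = (\<Sum>i=1..m. g (i - 1) * fs i)" "\<forall>i\<in>{1..m}. g (i - 1) \<in> polys_in m"
    by (auto simp: sum.atLeast1_atMost_eq)
  then show "p \<in> gen_ideal m fs" unfolding gen_ideal_def
    by (intro CollectI exI[of _ "\<lambda>i. g (i - 1)"] conjI)
qed

lemma gen_ideal_0: "0 \<in> gen_ideal m fs"
  unfolding gen_ideal_iff by (intro exI[of _ "\<lambda>_. 0"]) auto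

lemma gen_ideal_add: "p \<in> gen_ideal m fs \<Longrightarrow> q \<in> gen_ideal m fs \<Longrightarrow> p + q \<in> gen_ideal m fs"
  unfolding gen_ideal_iff
proof (elim exE conjE)
  fix g h assume "\<forall>k<m. g k \<in> polys_in m" "\<forall>k<m. h k \<in> polys_in m"
    "p = (\<Sum>k<m. g k * fs (Suc k))" "q = (\<Sum>k<m. h k * fs (Suc k))"
  then show "\<exists>g. (\<forall>k<m. g k \<in> polys_in m) \<and> p + q = (\<Sum>k<m. g k * fs (Suc k))"
    by (intro exI[of _ "\<lambda>k. g k + h k"]) (auto simp: distrib_right sum.distrib polys_in_add)
qed

lemma gen_ideal_mult: "p \<in> gen_ideal m fs \<Longrightarrow> r \<in> polys_in m \<Longrightarrow> r * p \<in> gen_ideal m fs"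
  unfolding gen_ideal_iff
proof (elim exE conjE)
  fix g assume "\<forall>k<m. g k \<in> polys_in m" "p = (\<Sum>k<m. g k * fs (Suc k))" "r \<in> polys_in m"
  then show "\<exists>g. (\<forall>k<m. g k \<in> polys_in m) \<and> r * p = (\<Sum>k<m. g k * fs (Suc k))"
    by (intro exI[of _ "\<lambda>k. r * g k"]) (auto simp: sum_distrib_left mult.assoc polys_in_mult)
qed

lemma gen_ideal_uminus: "p \<in> gen_ideal m fs \<Longrightarrow> - p \<in> gen_ideal m fs"
  using gen_ideal_mult[of p "- 1"] by (simp add: polys_in_uminus)

lemma gen_ideal_diff: "p \<in> gen_ideal m fs \<Longrightarrow> q \<in> gen_ideal m fs \<Longrightarrow> p - q \<in> gen_ideal m fs"
  using gen_ideal_add[of p "- q"] gen_ideal_uminus[of q] by simp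

lemma gen_ideal_sum: "(\<And>i. i \<in> S \<Longrightarrow> f i \<in> gen_ideal m fs) \<Longrightarrow> sum f S \<in> gen_ideal m fs"
  by (induction S rule: infinite_finite_induct) (auto intro: gen_ideal_0 gen_ideal_add)

lemma gen_ideal_generator: "i < m \<Longrightarrow> fs (Suc i) \<in> gen_ideal m fs"
proof -
  assume i: "i < m"
  have "(\<Sum>k<m. (if k = i then 1 else 0) * fs (Suc k)) = (\<Sum>k<m. if k = i then fs (Suc k) else 0)"
    by (rule sum.cong) auto
  also have "\<dots> = fs (Suc i)" using i by simp
  finally show ?thesis unfolding gen_ideal_iff
    by (intro exI[of _ "\<lambda>k. if k = i then 1 else 0"]) auto
qed

lemma gen_ideal_in:
  assumes "\<And>i. i < m \<Longrightarrow> fs (Suc i) \<in> polys_in m" "p \<in> gen_ideal m fs"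
  shows "p \<in> polys_in m"
  using assms by (auto simp: gen_ideal_iff intro!: polys_in_sum polys_in_mult)

end

section \<open>Monic univariate polynomials in the ideal\<close>

lemma nontrivial_dependency:
  fixes c :: "nat \<Rightarrow> 'b \<Rightarrow> 'a::field"
  assumes "finite B"
  obtains u k0 where "k0 \<le> card B" "u k0 \<noteq> 0" "\<And>b. b \<in> B \<Longrightarrow> (\<Sum>k\<le>card B. u k * c k b) = 0"
proof -
  define n where "n = card B"
  obtain e where e: "bij_betw e {0..<n} B" using ex_bij_betw_nat_finite[OF assms] n_def by auto
  \<comment> \<open>Padding the \<open>n\<close> equations in n + 1 unknowns with a zero row makes
    the matrix square and singular, so a nonzero kernel vector exists.\<close>
  define A where "A = mat (Suc n) (Suc n) (\<lambda>(i, j). if i < n then c j (e i) else 0)"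
  have A: "A \<in> carrier_mat (Suc n) (Suc n)" by (simp add: A_def)
  have "det A = (\<Sum>j<Suc n. A $$ (n, j) * cofactor A n j)"
    by (rule laplace_expansion_row[OF A]) simp
  also have "\<dots> = 0" by (rule sum.neutral) (auto simp: A_def)
  finally obtain v where v: "v \<in> carrier_vec (Suc n)" "v \<noteq> 0\<^sub>v (Suc n)" "A *\<^sub>v v = 0\<^sub>v (Suc n)"
    using det_0_iff_vec_prod_zero_field[OF A] by auto
  from v(1,2) obtain k0 where k0: "k0 < Suc n" "v $ k0 \<noteq> 0" by (metis eq_vecI carrier_vecD index_zero_vec)
  show ?thesis
  proof (rule that[of k0 "\<lambda>k. v $ k"])
    show "k0 \<le> card B" "v $ k0 \<noteq> 0" using k0 n_def by auto
    fix b assume "b \<in> B"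
    then obtain i where i: "i < n" "b = e i" using e by (auto simp: bij_betw_def)
    have "(A *\<^sub>v v) $ i = (\<Sum>k<Suc n. A $$ (i, k) * v $ k)"
      using i A v(1) by (simp add: scalar_prod_def atLeast0LessThan del: sum.lessThan_Suc)
    also have "\<dots> = (\<Sum>k<Suc n. v $ k * c k b)"
      by (rule sum.cong) (use i in \<open>auto simp: A_def mult.commute\<close>)
    finally show "(\<Sum>k\<le>card B. v $ k * c k b) = 0"
      using v(3) i by (simp add: n_def[symmetric] lessThan_Suc_atMost)
  qed
qed

definition upoly :: "'a::comm_ring_1 poly \<Rightarrow> 'a mpoly \<Rightarrow> 'a mpoly" where
  "upoly g x = (\<Sum>i\<le>degree g. mconst (coeff g i) * x ^ i)"

lemma upoly_superset: "degree g \<le> N \<Longrightarrow> upoly g x = (\<Sum>i\<le>N. mconst (coeff g i) * x ^ i)"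
  unfolding upoly_def by (rule sum.mono_neutral_left) (auto simp: coeff_eq_0)

text \<open>The quotient is spanned by \<open>B\<close>, so the powers of \<open>mvar j\<close> with
  exponents 0, ..., \<open>card B\<close> satisfy a linear relation modulo the ideal.\<close>

lemma fin_dim_univariate:
  fixes fs :: "nat \<Rightarrow> 'a::field mpoly"
  assumes fin: "fin_dim_quotient m (gen_ideal m fs)" and j: "j < m"
  obtains g where "lead_coeff g = 1" "degree g > 0" "upoly g (mvar j) \<in> gen_ideal m fs"
proof -
  let ?I = "gen_ideal m fs"
  obtain B where B: "finite B" "B \<subseteq> polys_in m"
    "\<And>p. p \<in> polys_in m \<Longrightarrow> \<exists>c. p - (\<Sum>b\<in>B. mconst (c b) * b) \<in> ?I"
    using fin unfolding fin_dim_quotient_def by blast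
  have "\<forall>k. \<exists>c. mvar j ^ k - (\<Sum>b\<in>B. mconst (c b) * b) \<in> ?I"
    by (intro allI B(3) polys_in_power polys_in_mvar j)
  from choice[OF this] obtain c where c: "\<And>k. mvar j ^ k - (\<Sum>b\<in>B. mconst (c k b) * b) \<in> ?I"
    by auto
  obtain u k0 where u: "k0 \<le> card B" "u k0 \<noteq> 0" "\<And>b. b \<in> B \<Longrightarrow> (\<Sum>k\<le>card B. u k * c k b) = 0"
    using nontrivial_dependency[OF B(1), of c] by blast
  let ?n = "card B"
  have "(\<Sum>k\<le>?n. mconst (u k) * (\<Sum>b\<in>B. mconst (c k b) * b)) =
      (\<Sum>b\<in>B. mconst (\<Sum>k\<le>?n. u k * c k b) * b)"
    unfolding mconst_sum sum_distrib_right sum_distrib_left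
    by (subst sum.swap) (simp add: mconst_mult mult.assoc)
  also have "\<dots> = 0" using u(3) by simp
  finally have "(\<Sum>k\<le>?n. mconst (u k) * mvar j ^ k) =
      (\<Sum>k\<le>?n. mconst (u k) * (mvar j ^ k - (\<Sum>b\<in>B. mconst (c k b) * b)))"
    by (simp add: right_diff_distrib sum_subtractf)
  also have "\<dots> \<in> ?I" using c by (intro gen_ideal_sum gen_ideal_mult) auto
  finally have uI: "(\<Sum>k\<le>?n. mconst (u k) * mvar j ^ k) \<in> ?I" .
  define P where "P = (\<Sum>k\<le>?n. monom (u k) k)"
  have coeffP: "coeff P k = (if k \<le> ?n then u k else 0)" for k
    by (simp add: P_def coeff_sum)
  have P0: "P \<noteq> 0" using u(1,2) coeffP[of k0] by auto
  have degP: "degree P \<le> ?n" by (rule degree_le) (simp add: coeffP)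
  \<comment> \<open>The extra factor x in \<open>pCons 0 P\<close> forces positive degree even when
    \<open>P\<close> is constant, which can happen for the unit ideal.\<close>
  define g where "g = Polynomial.smult (inverse (lead_coeff P)) (pCons 0 P)"
  have deg: "degree g = Suc (degree P)" using P0 by (simp add: g_def)
  have "upoly g (mvar j) = (\<Sum>i\<le>Suc ?n. mconst (coeff g i) * mvar j ^ i)"
    by (rule upoly_superset) (use deg degP in simp)
  also have "\<dots> = (\<Sum>k\<le>?n. mconst (inverse (lead_coeff P)) * mvar j * (mconst (u k) * mvar j ^ k))"
    by (subst sum.atMost_Suc_shift) (auto simp: g_def coeffP mconst_mult mult_ac intro!: sum.cong)
  also have "\<dots> = mconst (inverse (lead_coeff P)) * mvar j * (\<Sum>k\<le>?n. mconst (u k) * mvar j ^ k)"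
    by (simp only: sum_distrib_left)
  also have "\<dots> \<in> ?I" using uI j by (intro gen_ideal_mult polys_in_intros) auto
  finally have "upoly g (mvar j) \<in> ?I" .
  moreover have "lead_coeff g = 1" unfolding deg using P0 by (simp add: g_def)
  ultimately show ?thesis using deg by (intro that[of g]) simp_all
qed

text \<open>For monic \<open>g\<close> this is the sum of all residues of x^k / g, the univariate
  residue as a functional on powers.\<close>

definition top_coeff :: "'a::field poly \<Rightarrow> nat \<Rightarrow> 'a" where
  "top_coeff g k = coeff (monom 1 k mod g) (degree g - 1)"

text \<open>The polynomial x^k g has remainder 0 modulo \<open>g\<close>, so the functional vanishes
  on multiples of \<open>g\<close>.\<close>

lemma top_coeff_recurrence:
  "(\<Sum>i\<le>degree g. coeff g i * top_coeff g (k + i)) = 0"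
proof -
  have mod_sum: "(\<Sum>i\<in>S. f i) mod g = (\<Sum>i\<in>S. f i mod g)" if "finite S" for S and f :: "nat \<Rightarrow> 'a poly"
    using that by (induction S rule: finite_induct) (auto simp: poly_mod_add_left)
  have "monom 1 k * g = monom 1 k * (\<Sum>i\<le>degree g. monom (coeff g i) i)"
    by (simp add: poly_as_sum_of_monoms)
  also have "\<dots> = (\<Sum>i\<le>degree g. Polynomial.smult (coeff g i) (monom 1 (k + i)))"
    by (simp add: sum_distrib_left mult_monom smult_monom)
  finally have "(\<Sum>i\<le>degree g. Polynomial.smult (coeff g i) (monom 1 (k + i))) mod g = 0"
    by (metis mod_mult_self2_is_0)
  then have "(\<Sum>i\<le>degree g. Polynomial.smult (coeff g i) (monom 1 (k + i) mod g)) = 0"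
    by (simp add: mod_sum mod_smult_left)
  then have "coeff (\<Sum>i\<le>degree g. Polynomial.smult (coeff g i) (monom 1 (k + i) mod g)) (degree g - 1) = 0" by simp
  then show ?thesis by (simp add: coeff_sum top_coeff_def)
qed

lemma top_coeff_less: "k < degree g \<Longrightarrow> top_coeff g k = (if k = degree g - 1 then 1 else 0)"
  by (simp add: top_coeff_def mod_poly_less degree_monom_eq)

section \<open>Products of univariate residues\<close>

definition prod_functional :: "nat \<Rightarrow> (nat \<Rightarrow> nat \<Rightarrow> 'a::comm_ring_1) \<Rightarrow> (nat \<Rightarrow>\<^sub>0 nat) \<Rightarrow> 'a" where
  "prod_functional m \<tau> \<beta> = (\<Prod>j<m. \<tau> j (Poly_Mapping.lookup \<beta> j))"

text \<open>The product of sums expands over choice functions \<open>\<phi>\<close>. Each choice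
  gives a single monomial in y with a coefficient in x, and on a monomial the product functional
  factors by definition.\<close>

lemma yapply_prod_functional:
  assumes S: "\<And>j. j < m \<Longrightarrow> finite (S j)" and a: "\<And>j s. j < m \<Longrightarrow> s \<in> S j \<Longrightarrow> a j s \<in> polys_in m"
  shows "yapply m (prod_functional m \<tau>) (\<Prod>j<m. \<Sum>s\<in>S j. a j s * mvar (m + j) ^ e j s) =
    (\<Prod>j<m. \<Sum>s\<in>S j. a j s * mconst (\<tau> j (e j s)))"
proof -
  have mconst_prod: "mconst (prod f A) = (\<Prod>x\<in>A. mconst (f x))" for f :: "nat \<Rightarrow> 'b::comm_ring_1" and A
    by (induction A rule: infinite_finite_induct) (auto simp: mconst_mult)
  have "yapply m (prod_functional m \<tau>) (\<Prod>j<m. a j (\<phi> j) * mvar (m + j) ^ e j (\<phi> j)) =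
      (\<Prod>j<m. a j (\<phi> j) * mconst (\<tau> j (e j (\<phi> j))))" if \<phi>: "\<phi> \<in> PiE {..<m} S" for \<phi>
  proof -
    define \<gamma> where "\<gamma> = (\<Sum>j<m. Poly_Mapping.single (m + j) (e j (\<phi> j)))"
    have lk: "Poly_Mapping.lookup \<gamma> i = (\<Sum>j<m. if m + j = i then e j (\<phi> j) else 0)" for i
      by (simp add: \<gamma>_def lookup_sum lookup_single when_def)
    have "xpart m \<gamma> = 0"
      by (rule poly_mapping_eqI) (auto simp: lookup_xpart lk intro!: sum.neutral)
    moreover have "Poly_Mapping.lookup (ypart m \<gamma>) j = e j (\<phi> j)" if "j < m" for j
      using that by (simp add: lookup_ypart lk)
    ultimately have y: "yapply m (prod_functional m \<tau>) (mmonom \<gamma>) = (\<Prod>j<m. mconst (\<tau> j (e j (\<phi> j))))"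
      using yapply_monom[of m "prod_functional m \<tau>" 1 \<gamma>] by (simp add: prod_functional_def mconst_prod)
    have "(\<Prod>j<m. a j (\<phi> j) * mvar (m + j) ^ e j (\<phi> j)) = (\<Prod>j<m. a j (\<phi> j)) * mmonom \<gamma>"
      by (simp add: prod.distrib \<gamma>_def mmonom_sum mvar_power)
    moreover have "(\<Prod>j<m. a j (\<phi> j)) \<in> polys_in m" using \<phi> by (intro polys_in_prod a) auto
    ultimately show ?thesis by (simp add: yapply_x_mult y prod.distrib)
  qed
  then show ?thesis
    by (subst (1 2) prod_sum_PiE) (auto simp: S yapply_sum intro!: sum.cong)
qed

text \<open>In each monomial only the \<open>j\<close>-th factor of the functional sees the powers
  of \<open>mvar j\<close> coming from \<open>g\<close>; the other factors form the constant
  \<open>?R\<close>, and the recurrence makes the sum vanish.\<close>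

lemma functional_prod_functional:
  assumes j: "j < m" and rec: "\<And>k. (\<Sum>i\<le>degree g. coeff g i * \<tau> j (k + i)) = 0"
  shows "functional (prod_functional m \<tau>) (upoly g (mvar j) * p) = 0"
proof (induction p rule: mpoly_monom_induct)
  case (monom \<beta> c)
  let ?R = "\<Prod>l\<in>{..<m} - {j}. \<tau> l (Poly_Mapping.lookup \<beta> l)"
  have t: "prod_functional m \<tau> (Poly_Mapping.single j i + \<beta>) = \<tau> j (Poly_Mapping.lookup \<beta> j + i) * ?R" for i
  proof -
    have "prod_functional m \<tau> (Poly_Mapping.single j i + \<beta>) =
        \<tau> j (Poly_Mapping.lookup (Poly_Mapping.single j i + \<beta>) j) *
        (\<Prod>l\<in>{..<m} - {j}. \<tau> l (Poly_Mapping.lookup (Poly_Mapping.single j i + \<beta>) l))"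
      unfolding prod_functional_def using j by (simp add: prod.remove)
    also have "(\<Prod>l\<in>{..<m} - {j}. \<tau> l (Poly_Mapping.lookup (Poly_Mapping.single j i + \<beta>) l)) = ?R"
      by (rule prod.cong) (auto simp: lookup_add lookup_single when_def)
    finally show ?thesis by (simp add: lookup_add add.commute)
  qed
  have "upoly g (mvar j) * (mconst c * mmonom \<beta>) =
      (\<Sum>i\<le>degree g. mconst (c * coeff g i) * mmonom (Poly_Mapping.single j i + \<beta>))"
    by (simp add: upoly_def sum_distrib_left sum_distrib_right mvar_power mmonom_add mconst_mult mult_ac)
  then have "functional (prod_functional m \<tau>) (upoly g (mvar j) * (mconst c * mmonom \<beta>)) =
      (\<Sum>i\<le>degree g. c * coeff g i * (\<tau> j (Poly_Mapping.lookup \<beta> j + i) * ?R))"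
    by (simp add: functional_sum functional_mconst_mult functional_monom t)
  also have "\<dots> = c * ?R * (\<Sum>i\<le>degree g. coeff g i * \<tau> j (Poly_Mapping.lookup \<beta> j + i))"
    by (simp add: sum_distrib_left mult_ac)
  finally show ?case by (simp add: rec)
qed (auto simp: distrib_left functional_add)

text \<open>The quotient (g(x_j) - g(y_j)) / (x_j - y_j), expanded termwise. Pairs (n, i) are
  gathered in one \<open>SIGMA\<close> set so that \<open>yapply_prod_functional\<close>
  applies.\<close>

definition bez_univ :: "nat \<Rightarrow> nat \<Rightarrow> 'a::comm_ring_1 poly \<Rightarrow> 'a mpoly" where
  "bez_univ m j g = (\<Sum>(n, i)\<in>(SIGMA n:{..degree g}. {..<n}).
     mconst (coeff g n) * mvar j ^ (n - Suc i) * mvar (m + j) ^ i)"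

lemma bez_univ_mult:
  "bez_univ m j g * xy m j = upoly g (mvar j) - to_y m (upoly g (mvar j))"
proof -
  have "bez_univ m j g = (\<Sum>n\<le>degree g. \<Sum>i<n. mconst (coeff g n) * mvar j ^ (n - Suc i) * mvar (m + j) ^ i)"
    unfolding bez_univ_def by (subst sum.Sigma) auto
  then have "bez_univ m j g * xy m j = (\<Sum>n\<le>degree g. mconst (coeff g n) *
      - ((mvar (m + j) - mvar j) * (\<Sum>i<n. mvar j ^ (n - Suc i) * mvar (m + j) ^ i)))"
    by (simp add: xy_def sum_distrib_left sum_distrib_right sum_subtractf sum_negf algebra_simps)
  also have "\<dots> = (\<Sum>n\<le>degree g. mconst (coeff g n) * (mvar j ^ n - mvar (m + j) ^ n))"
    by (simp flip: power_diff_sumr2)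
  also have "\<dots> = upoly g (mvar j) - to_y m (upoly g (mvar j))"
    by (simp add: upoly_def to_y_def msubst_sum msubst_mult msubst_power right_diff_distrib sum_subtractf)
  finally show ?thesis .
qed

text \<open>With d = \<open>degree (g j)\<close>, the residue vanishes on y^i for i < d - 1 and is 1
  on y^(d-1). The only term with i = d - 1 is the one with n = d; it has coefficient 1 and no x
  left.\<close>

lemma yapply_prod_bez_univ:
  assumes "\<And>j. j < m \<Longrightarrow> lead_coeff (g j) = 1" "\<And>j. j < m \<Longrightarrow> degree (g j) > 0"
  shows "yapply m (prod_functional m (\<lambda>j. top_coeff (g j))) (\<Prod>j<m. bez_univ m j (g j)) = 1"
proof -
  let ?S = "\<lambda>j. SIGMA n:{..degree (g j)}. {..<n}"
  let ?a = "\<lambda>j (n, i). mconst (coeff (g j) n) * mvar j ^ (n - Suc i)"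
  have "(\<Prod>j<m. bez_univ m j (g j)) = (\<Prod>j<m. \<Sum>s\<in>?S j. ?a j s * mvar (m + j) ^ snd s)"
    by (simp add: bez_univ_def case_prod_unfold)
  then have "yapply m (prod_functional m (\<lambda>j. top_coeff (g j))) (\<Prod>j<m. bez_univ m j (g j)) =
      (\<Prod>j<m. \<Sum>s\<in>?S j. ?a j s * mconst (top_coeff (g j) (snd s)))"
    by (simp only:) (rule yapply_prod_functional, auto intro!: polys_in_mult polys_in_power polys_in_mvar)
  also have "\<dots> = (\<Prod>j<m. 1)"
  proof (rule prod.cong[OF refl])
    fix j assume "j \<in> {..<m}"
    then have j: "j < m" by simp
    let ?d = "degree (g j)"
    let ?s = "(?d, ?d - 1)"
    have "(\<Sum>s\<in>?S j. ?a j s * mconst (top_coeff (g j) (snd s))) =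
        (\<Sum>s\<in>{?s}. ?a j s * mconst (top_coeff (g j) (snd s)))"
    proof (rule sum.mono_neutral_right)
      show "{?s} \<subseteq> ?S j" using assms(2)[OF j] by auto
      show "\<forall>s\<in>?S j - {?s}. ?a j s * mconst (top_coeff (g j) (snd s)) = 0"
      proof
        fix s assume "s \<in> ?S j - {?s}"
        then have "snd s < ?d" "snd s \<noteq> ?d - 1" by (cases s; auto)+
        then show "?a j s * mconst (top_coeff (g j) (snd s)) = 0" by (simp add: top_coeff_less)
      qed
    qed auto
    also have "\<dots> = 1" using assms[OF j] by (simp add: top_coeff_less)
    finally show "(\<Sum>s\<in>?S j. ?a j s * mconst (top_coeff (g j) (snd s))) = 1" .
  qed
  finally show ?thesis by simp
qed

lemma functional_mult_kernel: "functional t (p * q) = functional (\<lambda>\<beta>. functional t (p * mmonom \<beta>)) q"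
proof (induction q rule: mpoly_monom_induct)
  case (monom \<alpha> c)
  show ?case by (simp add: mult.left_commute[of p] functional_mconst_mult functional_monom)
qed (auto simp: distrib_left functional_add)

lemma to_y_mult: "to_y m (p * q) = to_y m p * to_y m q"
  by (simp add: to_y_def msubst_mult)

text \<open>Writing the univariate polynomials \<open>g\<close> of the ideal as \<open>M f\<close>, the functional is
  \<open>h \<mapsto> \<tau>\<^sub>g (det M \<cdot> h)\<close> with \<open>\<tau>\<^sub>g\<close> a product of univariate residues (the transformation law).\<close>

lemma residue_exists:
  fixes fs :: "nat \<Rightarrow> 'a::field mpoly"
  assumes fs_in: "\<And>i. i < m \<Longrightarrow> fs (Suc i) \<in> polys_in m"
    and fin: "fin_dim_quotient m (gen_ideal m fs)"
  obtains t where "\<And>p. p \<in> gen_ideal m fs \<Longrightarrow> functional t p = 0"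
    "\<And>h. h \<in> polys_in m \<Longrightarrow> yapply m t (to_y m h * bez_delta m fs) - h \<in> gen_ideal m fs"
proof -
  let ?I = "gen_ideal m fs"
  have "\<forall>j. \<exists>g. j < m \<longrightarrow> lead_coeff g = 1 \<and> degree g > 0 \<and> upoly g (mvar j) \<in> ?I"
    using fin_dim_univariate[OF fin] by metis
  from choice[OF this] obtain g where g:
    "\<And>j. j < m \<Longrightarrow> lead_coeff (g j) = 1" "\<And>j. j < m \<Longrightarrow> degree (g j) > 0"
    "\<And>j. j < m \<Longrightarrow> upoly (g j) (mvar j) \<in> ?I" by auto
  define up where "up j = upoly (g j) (mvar j)" for j
  have up_I: "up j \<in> ?I" if "j < m" for j using g(3)[OF that] by (simp add: up_def)
  have up_in: "up j \<in> polys_in m" if "j < m" for j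
    using gen_ideal_in[of m fs, OF fs_in up_I[OF that]] .
  have "\<forall>j. \<exists>M. j < m \<longrightarrow> (\<forall>k<m. M k \<in> polys_in m) \<and> up j = (\<Sum>k<m. M k * fs (Suc k))"
    using up_I unfolding gen_ideal_iff by blast
  from choice[OF this] obtain M where M: "\<And>j k. j < m \<Longrightarrow> k < m \<Longrightarrow> M j k \<in> polys_in m"
    "\<And>j. j < m \<Longrightarrow> up j = (\<Sum>k<m. M j k * fs (Suc k))" by auto
  define MM where "MM = mat m m (\<lambda>(i, j). M i j)"
  have MM: "MM \<in> carrier_mat m m" by (simp add: MM_def)
  have detM_in: "det MM \<in> polys_in m" by (rule polys_in_det[OF _ MM]) (simp add: MM_def M)
  define t0 where "t0 = prod_functional m (\<lambda>j. top_coeff (g j))"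
  have t0_up: "functional t0 (up j * p) = 0" if "j < m" for j p
    unfolding t0_def up_def by (rule functional_prod_functional[OF that]) (rule top_coeff_recurrence)
  define t where "t = (\<lambda>\<beta>. functional t0 (det MM * mmonom \<beta>))"
  have t: "functional t p = functional t0 (det MM * p)" for p
    unfolding t_def by (rule functional_mult_kernel[symmetric])
  have t_I: "functional t p = 0" if p: "p \<in> ?I" for p
  proof -
    have fk: "functional t0 (det MM * fs (Suc k) * q) = 0" if k: "k < m" for k q
    proof -
      \<comment> \<open>Cramer's rule for \<open>up\<close> = M f:
        \<open>det MM * fs (Suc k)\<close> is a combination of the \<open>up j\<close>, whose
        multiples \<open>t0\<close> annihilates.\<close>
      have "(\<Sum>j<m. cofactor MM j k * up j) = (\<Sum>j<m. \<Sum>l<m. cofactor MM j k * MM $$ (j, l) * fs (Suc l))"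
        by (rule sum.cong) (auto simp: M(2) MM_def sum_distrib_left mult.assoc)
      also have "\<dots> = (\<Sum>l<m. (\<Sum>j<m. cofactor MM j k * MM $$ (j, l)) * fs (Suc l))"
        by (subst sum.swap) (simp add: sum_distrib_right)
      also have "\<dots> = (\<Sum>l<m. if k = l then det MM * fs (Suc l) else 0)"
        by (rule sum.cong) (use sum_cofactor_mult[OF MM k] in auto)
      also have "\<dots> = det MM * fs (Suc k)" using k by simp
      finally have "det MM * fs (Suc k) * q = (\<Sum>j<m. cofactor MM j k * up j) * q" by simp
      also have "\<dots> = (\<Sum>j<m. up j * (cofactor MM j k * q))"
        unfolding sum_distrib_right by (simp add: mult_ac)
      finally have "det MM * fs (Suc k) * q = (\<Sum>j<m. up j * (cofactor MM j k * q))" .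
      then show ?thesis by (simp add: functional_sum t0_up)
    qed
    obtain c where "p = (\<Sum>k<m. c k * fs (Suc k))" using p unfolding gen_ideal_iff by blast
    then have "det MM * p = (\<Sum>k<m. det MM * fs (Suc k) * c k)" by (simp add: sum_distrib_left mult_ac)
    then show ?thesis by (simp add: t functional_sum fk)
  qed
  define G where "G j = bez_univ m j (g j)" for j
  define PG where "PG = (\<Prod>j<m. G j)"
  define w where "w i = up i - to_y m (up i)" for i
  have G: "G j * xy m j = w j" for j by (simp add: G_def w_def up_def bez_univ_mult)
  have yI: "yapply m t0 (p * F) \<in> ?I" if "p \<in> ?I" for p F
    using gen_ideal_mult[OF that yapply_in[of m t0 F]] yapply_x_mult[of p m t0 F]
      gen_ideal_in[of m fs p, OF fs_in that] by (simp add: mult.commute)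
  have y0: "yapply m t0 (to_y m (up j) * F) = 0" if "j < m" for j F
    unfolding yapply_y_mult[OF up_in[OF that]] by (rule yapply_eq_0) (rule t0_up[OF that])
  \<comment> \<open>Multiples of w_j = up_j(x) - up_j(y) are mapped into the ideal: the x term since
    \<open>up j\<close> lies in it, the y term since \<open>t0\<close> annihilates it.\<close>
  have yw: "yapply m t0 (F * w j) \<in> ?I" if "j < m" for j F
  proof -
    have "yapply m t0 (F * w j) = yapply m t0 (up j * F) - yapply m t0 (to_y m (up j) * F)"
      by (simp add: w_def yapply_diff[symmetric] algebra_simps)
    then show ?thesis using yI[OF up_I[OF that]] y0[OF that] by simp
  qed
  \<comment> \<open>By the product rule M(x) f(x) - M(y) f(y) = M(y) (f(x) - f(y)) + f(x) (M(x) -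
    M(y)), the matrix \<open>D\<close> expresses the \<open>w i\<close> through the differences
    \<open>xy m j\<close>. So does the diagonal matrix \<open>D'\<close>.\<close>
  define D where "D = mat m m (\<lambda>(i, j). (\<Sum>k<m. to_y m (M i k) * divdiff m (Suc j) (fs (Suc k))) +
      (\<Sum>k<m. fs (Suc k) * divdiff m (Suc j) (M i k)))"
  define D' where "D' = mat m m (\<lambda>(i, j). if i = j then G i else 0)"
  define P where "P = map_mat (to_y m) MM * mat m m (\<lambda>(i, j). divdiff m (Suc j) (fs (Suc i)))"
  have carr: "D \<in> carrier_mat m m" "D' \<in> carrier_mat m m" by (simp_all add: D_def D'_def)
  have P: "P \<in> carrier_mat m m"
    unfolding P_def by (rule mult_carrier_mat[of _ m m]) (simp_all add: MM_def)
  have "upper_triangular D'" by (auto simp: D'_def)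
  then have detD': "det D' = PG"
    using det_upper_triangular[OF _ carr(2)] by (simp add: prod_list_diag_prod D'_def PG_def atLeast0LessThan)
  interpret comm_ring_hom "to_y m :: 'a mpoly \<Rightarrow> 'a mpoly"
    unfolding to_y_def by (rule comm_ring_hom_msubst)
  have detP: "det P = to_y m (det MM) * bez_delta m fs"
    unfolding P_def bez_delta_def using MM
    by (subst det_mult[of _ m]) auto
  \<comment> \<open>The second sum in the entries of \<open>D\<close> lies in the ideal of the
    f_k(x); dropping it leaves \<open>P\<close>, the product of M(y) with the matrix of divided
    differences.\<close>
  have "det D - det P \<in> fam_ideal m (\<lambda>k. fs (Suc k))"
  proof (rule det_diff_in_fam_ideal[OF carr(1) P])
    fix i j assume ij: "i < m" "j < m"
    have "P $$ (i, j) = (\<Sum>k<m. to_y m (M i k) * divdiff m (Suc j) (fs (Suc k)))"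
      using ij by (simp add: P_def MM_def scalar_prod_def atLeast0LessThan)
    then have "D $$ (i, j) - P $$ (i, j) = (\<Sum>k<m. divdiff m (Suc j) (M i k) * fs (Suc k))"
      using ij by (simp add: D_def mult.commute)
    also have "\<dots> \<in> fam_ideal m (\<lambda>k. fs (Suc k))" by (rule fam_idealI)
    finally show "D $$ (i, j) - P $$ (i, j) \<in> fam_ideal m (\<lambda>k. fs (Suc k))" .
  qed
  then obtain c where c: "det D - det P = (\<Sum>k<m. c k * fs (Suc k))" by (auto simp: fam_ideal_def)
  \<comment> \<open>Both matrices express the same \<open>w\<close> through the regular sequence of
    differences.\<close>
  have "det D - det D' \<in> fam_ideal m w"
  proof (rule det_diff_of_equal_combination[OF carr regular_seq_xy])
    fix i assume i: "i < m"
    have "(\<Sum>j<m. D $$ (i, j) * xy m j) =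
        (\<Sum>j<m. \<Sum>k<m. to_y m (M i k) * (divdiff m (Suc j) (fs (Suc k)) * xy m j)) +
        (\<Sum>j<m. \<Sum>k<m. fs (Suc k) * (divdiff m (Suc j) (M i k) * xy m j))"
      using i by (simp add: D_def distrib_right sum.distrib sum_distrib_right mult.assoc)
    also have "\<dots> = (\<Sum>k<m. \<Sum>j<m. to_y m (M i k) * (divdiff m (Suc j) (fs (Suc k)) * xy m j)) +
        (\<Sum>k<m. \<Sum>j<m. fs (Suc k) * (divdiff m (Suc j) (M i k) * xy m j))"
      by (intro arg_cong2[of _ _ _ _ "(+)"] sum.swap)
    also have "\<dots> = (\<Sum>k<m. to_y m (M i k) * (\<Sum>j<m. divdiff m (Suc j) (fs (Suc k)) * xy m j)) +
        (\<Sum>k<m. fs (Suc k) * (\<Sum>j<m. divdiff m (Suc j) (M i k) * xy m j))"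
      by (simp only: sum_distrib_left)
    also have "\<dots> = (\<Sum>k<m. to_y m (M i k) * (fs (Suc k) - to_y m (fs (Suc k)))) +
        (\<Sum>k<m. fs (Suc k) * (M i k - to_y m (M i k)))"
      using i by (simp add: sum_divdiff fs_in M)
    also have "\<dots> = (\<Sum>k<m. M i k * fs (Suc k) - to_y m (M i k) * to_y m (fs (Suc k)))"
      by (simp add: sum.distrib[symmetric] algebra_simps)
    also have "\<dots> = w i" using i
      by (simp add: w_def M(2) to_y_def msubst_sum msubst_mult sum_subtractf)
    finally show "(\<Sum>j<m. D $$ (i, j) * xy m j) = w i" .
    have "(\<Sum>j<m. D' $$ (i, j) * xy m j) = (\<Sum>j<m. if i = j then G i * xy m j else 0)"
      by (rule sum.cong) (use i in \<open>auto simp: D'_def\<close>)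
    then show "(\<Sum>j<m. D' $$ (i, j) * xy m j) = w i" using i G by simp
  qed
  then obtain d where d: "det D - det D' = (\<Sum>i<m. d i * w i)" by (auto simp: fam_ideal_def)
  have key: "to_y m (det MM) * bez_delta m fs = PG + (\<Sum>i<m. d i * w i) - (\<Sum>k<m. c k * fs (Suc k))"
    using c d detP detD' by (simp add: algebra_simps)
  have yPG: "yapply m t0 PG = 1"
    unfolding t0_def PG_def G_def by (rule yapply_prod_bez_univ) (use g in auto)
  have "yapply m t (to_y m h * bez_delta m fs) - h \<in> ?I" if h: "h \<in> polys_in m" for h
  proof -
    have "yapply m t (to_y m h * bez_delta m fs) = yapply m t0 (to_y m (det MM) * (to_y m h * bez_delta m fs))"
      unfolding t_def by (rule yapply_y_mult[OF detM_in, symmetric])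
    also have "to_y m (det MM) * (to_y m h * bez_delta m fs) =
        to_y m h * (to_y m (det MM) * bez_delta m fs)" by (simp add: mult_ac)
    \<comment> \<open>In front of \<open>PG\<close>, h(y) is replaced by h(x), which can be taken
      out of \<open>yapply\<close>; the correction term is treated next.\<close>
    also have "\<dots> = h * PG - (h - to_y m h) * PG + (\<Sum>i<m. to_y m h * d i * w i) -
        (\<Sum>k<m. fs (Suc k) * (to_y m h * c k))"
      unfolding key by (simp add: algebra_simps sum_distrib_left)
    \<comment> \<open>h(x) - h(y) is a combination of the \<open>xy m l\<close>, and multiplication
      by \<open>xy m l\<close> turns the factor \<open>G l\<close> of \<open>PG\<close> into
      \<open>w l\<close>.\<close>
    also have "(h - to_y m h) * PG = (\<Sum>l<m. divdiff m (Suc l) h * (\<Prod>j\<in>{..<m} - {l}. G j) * w l)"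
    proof -
      have "(h - to_y m h) * PG = (\<Sum>l<m. divdiff m (Suc l) h * xy m l * PG)"
        unfolding sum_divdiff[OF h, symmetric] by (simp add: sum_distrib_right)
      also have "\<dots> = (\<Sum>l<m. divdiff m (Suc l) h * (\<Prod>j\<in>{..<m} - {l}. G j) * w l)"
      proof (rule sum.cong[OF refl])
        fix l assume "l \<in> {..<m}"
        then have "PG = G l * (\<Prod>j\<in>{..<m} - {l}. G j)" unfolding PG_def by (simp add: prod.remove)
        then show "divdiff m (Suc l) h * xy m l * PG = divdiff m (Suc l) h * (\<Prod>j\<in>{..<m} - {l}. G j) * w l"
          using G[of l] by (simp add: mult_ac)
      qed
      finally show ?thesis .
    qed
    finally have "yapply m t (to_y m h * bez_delta m fs) - h =
        - (\<Sum>l<m. yapply m t0 (divdiff m (Suc l) h * (\<Prod>j\<in>{..<m} - {l}. G j) * w l)) +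
        (\<Sum>i<m. yapply m t0 (to_y m h * d i * w i)) - (\<Sum>k<m. yapply m t0 (fs (Suc k) * (to_y m h * c k)))"
      by (simp add: yapply_add yapply_diff yapply_sum yapply_x_mult[OF h] yPG)
    also have "\<dots> \<in> ?I"
      by (intro gen_ideal_diff gen_ideal_add gen_ideal_uminus gen_ideal_sum yw yI gen_ideal_generator) auto
    finally show ?thesis .
  qed
  then show ?thesis using that[of t] t_I by blast
qed

subsection \<open>The Jacobian and the nilradical\<close>

text \<open>\<open>T\<close> turns products into matrix products, and \<open>T h\<close> has trace
  t(h J). If g J lies in the ideal, all positive powers of \<open>T g\<close> have trace 0, so
  \<open>T g\<close> is nilpotent. Conversely, if g is nilpotent modulo the ideal then so is each g
  b_i; hence t(g J b_i) = 0, and by \<open>rep\<close> this puts g J into the ideal.\<close>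

lemma frobenius_annihilator:
  fixes fs :: "nat \<Rightarrow> 'a::{alg_closed_field, field_char_0} mpoly" and n :: nat
  assumes fs_in: "\<And>i. i < m \<Longrightarrow> fs (Suc i) \<in> polys_in m"
    and t: "\<And>p. p \<in> gen_ideal m fs \<Longrightarrow> functional t p = 0"
    and ab: "\<And>i. i < n \<Longrightarrow> a i \<in> polys_in m" "\<And>i. i < n \<Longrightarrow> b i \<in> polys_in m"
    and rep: "\<And>h. h \<in> polys_in m \<Longrightarrow> (\<Sum>i<n. mconst (functional t (h * b i)) * a i) - h \<in> gen_ideal m fs"
    and J: "J = (\<Sum>i<n. a i * b i)" and g: "g \<in> polys_in m"
  shows "g * J \<in> gen_ideal m fs \<longleftrightarrow> (\<exists>k. g ^ k \<in> gen_ideal m fs)"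
proof -
  let ?I = "gen_ideal m fs"
  define T where "T h = mat n n (\<lambda>(i, j). functional t (h * a i * b j))" for h
  have T: "T h \<in> carrier_mat n n" for h by (simp add: T_def)
  \<comment> \<open>This is \<open>rep\<close> multiplied by \<open>q\<close>, with \<open>t\<close>
    applied.\<close>
  have repr: "functional t (q * h) = (\<Sum>j<n. functional t (h * b j) * functional t (q * a j))"
    if "h \<in> polys_in m" "q \<in> polys_in m" for h q
  proof -
    have "functional t (q * ((\<Sum>i<n. mconst (functional t (h * b i)) * a i) - h)) = 0"
      by (rule t) (rule gen_ideal_mult[OF rep[OF that(1)] that(2)])
    moreover have "q * (\<Sum>i<n. mconst (functional t (h * b i)) * a i) =
        (\<Sum>i<n. mconst (functional t (h * b i)) * (q * a i))"
      by (simp add: sum_distrib_left mult_ac)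
    ultimately show ?thesis
      by (simp add: right_diff_distrib functional_diff functional_sum functional_mconst_mult)
  qed
  have T_mult: "T h * T k = T (h * k)" if "h \<in> polys_in m" "k \<in> polys_in m" for h k
  proof (rule eq_matI)
    fix i l assume "i < dim_row (T (h * k))" "l < dim_col (T (h * k))"
    then have il: "i < n" "l < n" by (simp_all add: T_def)
    have "(T h * T k) $$ (i, l) = (\<Sum>j<n. functional t (h * a i * b j) * functional t (k * b l * a j))"
      using il by (simp add: T_def scalar_prod_def atLeast0LessThan mult_ac)
    also have "\<dots> = functional t (k * b l * (h * a i))"
      by (rule repr[symmetric]) (use that il ab in \<open>auto intro: polys_in_mult\<close>)
    finally show "(T h * T k) $$ (i, l) = T (h * k) $$ (i, l)"
      using il by (simp add: T_def mult_ac)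
  qed (auto simp: T_def)
  \<comment> \<open>\<open>T 1\<close> need not be the unit matrix, so powers are compared only for
    positive exponents.\<close>
  have T_pow: "T h ^\<^sub>m Suc k = T (h ^ Suc k)" if "h \<in> polys_in m" for h k
  proof (induction k)
    case 0
    then show ?case using T[of h] by simp
  next
    case (Suc k)
    have "T h ^\<^sub>m Suc (Suc k) = T (h ^ Suc k) * T h" using Suc by simp
    also have "\<dots> = T (h ^ Suc k * h)" by (rule T_mult) (use that in \<open>auto intro: polys_in_intros\<close>)
    finally show ?case by (simp add: mult.commute)
  qed
  have trace: "mat_trace (T h) = functional t (h * J)" for h
    by (simp add: mat_trace_def T_def J sum_distrib_left functional_sum mult.assoc)
  have J_in: "J \<in> polys_in m" unfolding J by (intro polys_in_sum polys_in_mult ab) auto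
  have in_I: "h \<in> ?I" if "h \<in> polys_in m" "\<And>i. i < n \<Longrightarrow> functional t (h * b i) = 0" for h
    using gen_ideal_uminus[OF rep[OF that(1)]] that(2) by simp
  show ?thesis
  proof
    assume gJ: "g * J \<in> ?I"
    have "mat_trace (T g ^\<^sub>m k) = 0" if k: "k > 0" for k
    proof -
      obtain l where l: "k = Suc l" using k by (cases k) auto
      have "g ^ l * (g * J) \<in> ?I" by (rule gen_ideal_mult[OF gJ]) (intro polys_in_power g)
      then have "functional t (g ^ Suc l * J) = 0" using t by (simp add: mult_ac)
      then show ?thesis unfolding l T_pow[OF g] trace .
    qed
    then have "T g ^\<^sub>m n = 0\<^sub>m n n" by (rule trace_pow_zero_imp_nilpotent[OF T])
    then have "T g ^\<^sub>m Suc n = 0\<^sub>m n n" using T[of g] by simp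
    then have T0: "T (g ^ Suc n) = 0\<^sub>m n n" unfolding T_pow[OF g] .
    let ?q = "g ^ Suc n"
    have q: "?q \<in> polys_in m" by (intro polys_in_power g)
    have qa: "?q * a i \<in> ?I" if i: "i < n" for i
    proof (rule in_I)
      show "?q * a i \<in> polys_in m" by (intro polys_in_mult q ab i)
      fix j assume j: "j < n"
      have "functional t (?q * a i * b j) = T ?q $$ (i, j)" using i j by (simp add: T_def)
      then show "functional t (?q * a i * b j) = 0" using T0 i j by simp
    qed
    \<comment> \<open>\<open>T ?q = 0\<close> only places the products \<open>?q * a i\<close> in
      the ideal. Expanding with \<open>repr\<close> transfers this to the square of
      \<open>?q\<close>, paired with \<open>b i\<close>.\<close>
    have "functional t (?q * ?q * b i) = 0" if i: "i < n" for i
    proof -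
      have "functional t (?q * b i * ?q) = (\<Sum>j<n. functional t (?q * b j) * functional t (?q * b i * a j))"
        by (rule repr) (use q ab i in \<open>auto intro: polys_in_mult\<close>)
      also have "\<dots> = 0"
      proof (rule sum.neutral, rule ballI)
        fix j assume "j \<in> {..<n}"
        then have "b i * (?q * a j) \<in> ?I" by (intro gen_ideal_mult[OF qa] ab i) auto
        then have "functional t (b i * (?q * a j)) = 0" by (rule t)
        then show "functional t (?q * b j) * functional t (?q * b i * a j) = 0" by (simp add: mult_ac)
      qed
      finally show ?thesis by (simp add: mult_ac)
    qed
    then have "?q * ?q \<in> ?I" by (intro in_I polys_in_mult q)
    then have "g ^ (Suc n + Suc n) \<in> ?I" by (simp only: power_add)
    then show "\<exists>k. g ^ k \<in> ?I" by blast
  next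
    assume "\<exists>k. g ^ k \<in> ?I"
    then obtain k where k: "g ^ k \<in> ?I" by blast
    show "g * J \<in> ?I"
    proof (rule in_I)
      show "g * J \<in> polys_in m" by (intro polys_in_mult g J_in)
      fix i assume i: "i < n"
      let ?h = "g * b i"
      have h: "?h \<in> polys_in m" by (intro polys_in_mult g ab i)
      have "(g * b i ^ Suc k) * g ^ k \<in> ?I"
        by (rule gen_ideal_mult[OF k]) (intro polys_in_mult polys_in_power g ab i)
      then have hk: "?h ^ Suc k \<in> ?I" by (simp add: power_mult_distrib mult_ac)
      have "T (?h ^ Suc k) = 0\<^sub>m n n"
      proof (rule eq_matI)
        fix i j assume "i < dim_row (0\<^sub>m n n)" "j < dim_col (0\<^sub>m n n)"
        then have ij: "i < n" "j < n" by simp_all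
        have "a i * b j * ?h ^ Suc k \<in> ?I" by (rule gen_ideal_mult[OF hk]) (intro polys_in_mult ab ij)
        then have "functional t (?h ^ Suc k * a i * b j) = 0" using t by (simp only: mult_ac)
        then show "T (?h ^ Suc k) $$ (i, j) = 0\<^sub>m n n $$ (i, j)" using ij by (simp add: T_def)
      qed (auto simp: T_def)
      then have "mat_trace (T ?h) = 0" using nilpotent_mat_trace[OF T] T_pow[OF h] by metis
      then show "functional t (g * J * b i) = 0" unfolding trace by (simp add: mult_ac)
    qed
  qed
qed

text \<open>The \<open>a i\<close> and \<open>b i\<close> are taken as the x and y parts of the
  monomials of \<open>\<Delta>\<close>, with the coefficients put into \<open>a\<close>. Setting y =
  x in \<open>\<Delta>\<close> shows that the sum of the products \<open>a i * b i\<close> is the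
  Jacobian.\<close>

lemma jacobian_annihilator:
  fixes fs :: "nat \<Rightarrow> 'a::{alg_closed_field, field_char_0} mpoly"
  assumes fs_in: "\<And>i. i < m \<Longrightarrow> fs (Suc i) \<in> polys_in m"
    and t: "\<And>p. p \<in> gen_ideal m fs \<Longrightarrow> functional t p = 0"
    and rep: "\<And>h. h \<in> polys_in m \<Longrightarrow> yapply m t (to_y m h * bez_delta m fs) - h \<in> gen_ideal m fs"
    and g: "g \<in> polys_in m"
  shows "g * jacobian m fs \<in> gen_ideal m fs \<longleftrightarrow> (\<exists>k. g ^ k \<in> gen_ideal m fs)"
proof -
  let ?\<Delta> = "bez_delta m fs"
  let ?K = "Poly_Mapping.keys ?\<Delta>"
  define n where "n = card ?K"
  obtain e where e: "bij_betw e {0..<n} ?K"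
    using ex_bij_betw_nat_finite[OF finite_keys[of ?\<Delta>]] n_def by auto
  define a where "a i = mconst (Poly_Mapping.lookup ?\<Delta> (e i)) * mmonom (xpart m (e i))" for i
  define b where "b i = (mmonom (ypart m (e i)) :: 'a mpoly)" for i
  have sum_e: "(\<Sum>\<gamma>\<in>?K. f \<gamma>) = (\<Sum>i<n. f (e i))" for f :: "_ \<Rightarrow> 'a mpoly"
    using sum.reindex_bij_betw[OF e, of f] by (simp add: atLeast0LessThan)
  show ?thesis
  proof (rule frobenius_annihilator[where t = t and a = a and b = b and n = n])
    show "fs (Suc i) \<in> polys_in m" if "i < m" for i by (rule fs_in[OF that])
    show "functional t p = 0" if "p \<in> gen_ideal m fs" for p by (rule t[OF that])
    show "g \<in> polys_in m" by (rule g)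
    show "a i \<in> polys_in m" "b i \<in> polys_in m" for i
      unfolding a_def b_def by (intro polys_in_intros keys_xpart keys_ypart)+
    show "(\<Sum>i<n. mconst (functional t (h * b i)) * a i) - h \<in> gen_ideal m fs" if h: "h \<in> polys_in m" for h
    proof -
      have "yapply m t (to_y m h * ?\<Delta>) = (\<Sum>i<n. mconst (functional t (h * b i)) * a i)"
        unfolding yapply_y_mult[OF h] unfolding yapply_def lin_ext_def sum_e a_def b_def by (simp add: mult_ac)
      then show ?thesis using rep[OF h] by simp
    qed
    have "jacobian m fs = diag m ?\<Delta>" by (simp add: diag_bez_delta fs_in)
    also have "\<dots> = diag m (\<Sum>\<gamma>\<in>?K. mconst (Poly_Mapping.lookup ?\<Delta> \<gamma>) * mmonom \<gamma>)"
      by (subst mpoly_expand) (rule refl)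
    also have "\<dots> = (\<Sum>\<gamma>\<in>?K. mconst (Poly_Mapping.lookup ?\<Delta> \<gamma>) * (mmonom (xpart m \<gamma>) * mmonom (ypart m \<gamma>)))"
      unfolding diag_def msubst_sum msubst_mconst_mult
    proof (intro sum.cong refl arg_cong2[of _ _ _ _ "(*)"])
      fix \<gamma> assume "\<gamma> \<in> ?K"
      then have \<gamma>: "Poly_Mapping.keys \<gamma> \<subseteq> {..<2 * m}"
        using bez_delta_in[of m fs] fs_in by (auto simp: polys_in_def)
      let ?\<sigma> = "\<lambda>k. if k < m then mvar k else mvar (k - m) :: 'a mpoly"
      have "msubst ?\<sigma> (mmonom \<gamma>) = msubst ?\<sigma> (mmonom (xpart m \<gamma>)) * msubst ?\<sigma> (to_y m (mmonom (ypart m \<gamma>)))"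
        unfolding to_y_mmonom msubst_mult[symmetric] mmonom_add[symmetric] xpart_plus_yshift_ypart[OF \<gamma>] ..
      also have "msubst ?\<sigma> (mmonom (xpart m \<gamma>)) = msubst mvar (mmonom (xpart m \<gamma>))"
        by (rule msubst_cong[OF polys_in_mmonom[OF keys_xpart]]) simp
      also have "msubst ?\<sigma> (to_y m (mmonom (ypart m \<gamma>))) = msubst mvar (mmonom (ypart m \<gamma>))"
        unfolding to_y_def msubst_msubst by simp
      finally show "msubst ?\<sigma> (mmonom \<gamma>) = mmonom (xpart m \<gamma>) * mmonom (ypart m \<gamma>)"
        by (simp only: msubst_mvar_id)
    qed
    also have "\<dots> = (\<Sum>i<n. a i * b i)" unfolding sum_e a_def b_def by (simp add: mult.assoc)
    finally show "jacobian m fs = (\<Sum>i<n. a i * b i)" .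
  qed
qed

section \<open>The radical from the kernel of the Bezoutian of the Jacobian\<close>

theorem theorem4p3:
  fixes m :: nat
    and fs :: "nat \<Rightarrow> 'a::{alg_closed_field, field_char_0} mpoly"
    and E E' :: "(nat \<Rightarrow>\<^sub>0 nat) set"
  assumes fs_in: "\<forall>i\<in>{1..m}. fs i \<in> polys_in m"
    and fin: "fin_dim_quotient m (gen_ideal m fs)"
    and E_fin: "finite E" and E'_fin: "finite E'"
    and E_vars: "\<forall>\<alpha>\<in>E. Poly_Mapping.keys \<alpha> \<subseteq> {..<m}"
    and E'_vars: "\<forall>\<beta>\<in>E'. Poly_Mapping.keys \<beta> \<subseteq> {..<m}"
    and supp: "\<forall>f0\<in>{1, jacobian m fs}. \<forall>\<alpha> \<beta>. Poly_Mapping.keys \<alpha> \<subseteq> {..<m} \<longrightarrow> Poly_Mapping.keys \<beta> \<subseteq> {..<m} \<longrightarrow>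
                 bez_coeff m fs f0 \<alpha> \<beta> \<noteq> 0 \<longrightarrow> \<alpha> \<in> E \<and> \<beta> \<in> E'"
  shows "radical_in m (gen_ideal m fs) =
     {(\<Sum>\<alpha>\<in>E. \<Sum>\<beta>\<in>E'. mconst (bez_coeff m fs 1 \<alpha> \<beta> * lam \<beta>) * mmonom \<alpha>) + q | lam q.
        (\<Sum>\<alpha>\<in>E. \<Sum>\<beta>\<in>E'. mconst (bez_coeff m fs (jacobian m fs) \<alpha> \<beta> * lam \<beta>) * mmonom \<alpha>) = 0
        \<and> q \<in> gen_ideal m fs}"
proof -
  let ?I = "gen_ideal m fs" and ?J = "jacobian m fs" and ?\<Delta> = "bez_delta m fs"
  have fs: "fs (Suc i) \<in> polys_in m" if "i < m" for i using fs_in that by auto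
  have J_in: "?J \<in> polys_in m" by (rule jacobian_in) (rule fs)
  have apply_bez: "(\<Sum>\<alpha>\<in>E. \<Sum>\<beta>\<in>E'. mconst (bez_coeff m fs f0 \<alpha> \<beta> * lam \<beta>) * mmonom \<alpha>) =
      yapply m lam (bezoutian m fs f0)" if "f0 \<in> {1, ?J}" for f0 lam
    unfolding bez_coeff_def
  proof (rule yapply_coeff_sum[OF _ E_fin E'_fin E_vars E'_vars])
    show "bezoutian m fs f0 \<in> polys_in (2 * m)"
      by (rule bezoutian_in) (use fs J_in that in auto)
  qed (use supp that in \<open>unfold bez_coeff_def, blast\<close>)
  obtain t where t: "\<And>p. p \<in> ?I \<Longrightarrow> functional t p = 0"
    and rep: "\<And>h. h \<in> polys_in m \<Longrightarrow> yapply m t (to_y m h * ?\<Delta>) - h \<in> ?I"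
    using residue_exists[of m fs, OF fs fin] by blast
  have ann: "g * ?J \<in> ?I \<longleftrightarrow> (\<exists>k. g ^ k \<in> ?I)" if "g \<in> polys_in m" for g
    by (rule jacobian_annihilator[OF fs t rep that])
  obtain c where
    cx: "bezoutian m fs ?J = ?J * ?\<Delta> + (\<Sum>i<m. fs (Suc i) * c i)" and
    cy: "bezoutian m fs ?J = to_y m ?J * ?\<Delta> + (\<Sum>i<m. to_y m (fs (Suc i)) * c i)"
    using bezoutian_expand[of m fs ?J, OF fs J_in] by blast
  have "p \<in> radical_in m ?I \<longleftrightarrow>
      (\<exists>lam q. p = yapply m lam ?\<Delta> + q \<and> yapply m lam (bezoutian m fs ?J) = 0 \<and> q \<in> ?I)" for p
  proof
    assume "p \<in> radical_in m ?I"
    then have p: "p \<in> polys_in m" and "\<exists>k. p ^ k \<in> ?I" by (auto simp: radical_in_def)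
    then have pJ: "p * ?J \<in> ?I" using ann by blast
    \<comment> \<open>The functional \<open>t\<close> after multiplication by \<open>p\<close>; by
      \<open>rep\<close> it recovers \<open>p\<close> from \<open>\<Delta>\<close> modulo the
      ideal.\<close>
    define lam where "lam = (\<lambda>\<beta>. functional t (p * mmonom \<beta>))"
    have lam: "yapply m lam F = yapply m t (to_y m p * F)" for F
      unfolding lam_def by (rule yapply_y_mult[OF p, symmetric])
    have y0: "yapply m t (to_y m q * F) = 0" if "q \<in> ?I" for q F
    proof -
      have "q \<in> polys_in m" using gen_ideal_in[of m fs q, OF fs that] .
      then show ?thesis
        using t gen_ideal_mult[OF that polys_in_mmonom]
        by (simp add: yapply_y_mult) (rule yapply_eq_0, simp add: mult.commute)
    qed
    \<comment> \<open>The expansion in y is used here: after multiplication by p(y) every term has a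
      factor p J or p f_i in y, and these lie in the ideal annihilated by \<open>t\<close>.\<close>
    have "yapply m lam (bezoutian m fs ?J) =
        yapply m t (to_y m (p * ?J) * ?\<Delta>) + (\<Sum>i<m. yapply m t (to_y m (p * fs (Suc i)) * c i))"
      unfolding lam cy by (simp add: yapply_add yapply_sum distrib_left sum_distrib_left to_y_mult mult.assoc)
    also have "\<dots> = 0"
      using pJ p by (simp add: y0 gen_ideal_mult gen_ideal_generator)
    finally have "yapply m lam (bezoutian m fs ?J) = 0" .
    moreover have "p - yapply m lam ?\<Delta> \<in> ?I"
      using gen_ideal_uminus[OF rep[OF p]] by (simp add: lam)
    moreover have "p = yapply m lam ?\<Delta> + (p - yapply m lam ?\<Delta>)" by simp
    ultimately show "\<exists>lam q. p = yapply m lam ?\<Delta> + q \<and> yapply m lam (bezoutian m fs ?J) = 0 \<and> q \<in> ?I"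
      by blast
  next
    assume "\<exists>lam q. p = yapply m lam ?\<Delta> + q \<and> yapply m lam (bezoutian m fs ?J) = 0 \<and> q \<in> ?I"
    then obtain lam q where p: "p = yapply m lam ?\<Delta> + q"
      and 0: "yapply m lam (bezoutian m fs ?J) = 0" and q: "q \<in> ?I" by blast
    \<comment> \<open>Here the expansion in x is used, since factors in x come out of
      \<open>yapply\<close> for every \<open>lam\<close>.\<close>
    have "0 = ?J * yapply m lam ?\<Delta> + (\<Sum>i<m. fs (Suc i) * yapply m lam (c i))"
      using 0 unfolding cx by (simp add: yapply_add yapply_sum yapply_x_mult J_in fs)
    then have "p * ?J = ?J * q - (\<Sum>i<m. yapply m lam (c i) * fs (Suc i))"
      unfolding p by (simp add: algebra_simps eq_neg_iff_add_eq_0)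
    also have "\<dots> \<in> ?I"
      by (intro gen_ideal_diff gen_ideal_sum gen_ideal_mult q J_in gen_ideal_generator yapply_in) auto
    finally have "p * ?J \<in> ?I" .
    moreover have "p \<in> polys_in m"
      unfolding p using gen_ideal_in[of m fs q, OF fs q] by (intro polys_in_add yapply_in)
    ultimately show "p \<in> radical_in m ?I" using ann by (simp add: radical_in_def)
  qed
  then show ?thesis by (auto simp: apply_bez bezoutian_1[of m fs, OF fs])
qed

end
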